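(* Let $c>0$ and $T>0$ be constants and let $y_0$ be a given initial function on $[0,1]$. For $\Theta=(\theta_1,\theta_2)^\top\in\mathbb{R}^2$ let $k(x;\Theta)=\theta_1x+\theta_2x^2$, let $y(x,t;\Theta)$ be the solution of the closed-loop state system and $v(x,t;\Theta)$ the solution of the costate system (both given in the context), and let $$g_0(\Theta)=\frac12\int_0^T\int_0^1 y^2(x,t;\Theta)\,dx\,dt+\frac12\int_0^1k^2(x;\Theta)\,dx .$$ Then the gradient of $g_0$ is given by $$\nabla_{\theta_1} g_0(\Theta)=-\int_0^T\int_0^1 x\,v_x(1,t;\Theta)\,y(x,t;\Theta)\,dx\,dt+\frac13\theta_1+\frac14\theta_2,$$ $$\nabla_{\theta_2} g_0(\Theta)=-\int_0^T\int_0^1 x^2\,v_x(1,t;\Theta)\,y(x,t;\Theta)\,dx\,dt+\frac14\theta_1+\frac15\theta_2 .$$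
   Context: The closed-loop state system, for $x\in[0,1]$, $t\in[0,T]$, is $$y_t(x,t)=y_{xx}(x,t)+c\,y(x,t),\quad y(x,0)=y_0(x),\quad y(0,t)=0,\quad y(1,t)=\int_0^1k(\xi;\Theta)y(\xi,t)\,d\xi ,$$ and $y(x,t;\Theta)$ denotes its solution; existence and uniqueness of this solution is taken as known. The costate system corresponding to $\Theta$ is the backward-in-time problem $$v_t(x,t)+v_{xx}(x,t)+c\,v(x,t)+y(x,t;\Theta)-k(x;\Theta)\,v_x(1,t)=0,$$ $$v(0,t)=v(1,t)=0,\qquad v(x,T)=0,$$ and $v(x,t;\Theta)$ denotes its solution. Here $v_x(1,t;\Theta)$ is the spatial derivative of $v$ at the boundary point $x=1$, and $\nabla_{\theta_i}$ denotes the partial derivative with respect to $\theta_i$. *)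

theory Defs
  imports "HOL-Analysis.Analysis"
begin

text \<open>
  Functions on \<open>[0,1] \<times> [0,T]\<close> are curried as \<open>u x t\<close>. Values outside this rectangle are irrelevant, so
  derivatives are taken within it (one-sided at its edges).
\<close>

definition partial_x :: "(real \<Rightarrow> real \<Rightarrow> real) \<Rightarrow> real \<Rightarrow> real \<Rightarrow> real" where
  "partial_x u x t = vector_derivative (\<lambda>\<xi>. u \<xi> t) (at x within {0..1})"

definition partial_t :: "real \<Rightarrow> (real \<Rightarrow> real \<Rightarrow> real) \<Rightarrow> real \<Rightarrow> real \<Rightarrow> real" where
  "partial_t T u x t = vector_derivative (\<lambda>s. u x s) (at t within {0..T})"

text \<open>\<open>u\<close> is of class \<open>C\<^sup>1\<close> in \<open>x\<close> on \<open>[0,1] \<times> I\<close>, jointly continuous together with its derivative.\<close>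

definition C1_x :: "real set \<Rightarrow> (real \<Rightarrow> real \<Rightarrow> real) \<Rightarrow> bool" where
  "C1_x I u \<longleftrightarrow>
     (\<forall>x\<in>{0..1}. \<forall>t\<in>I. (\<lambda>\<xi>. u \<xi> t) differentiable (at x within {0..1})) \<and>
     continuous_on ({0..1} \<times> I) (\<lambda>(x, t). u x t) \<and>
     continuous_on ({0..1} \<times> I) (\<lambda>(x, t). partial_x u x t)"

text \<open>The parabolic class \<open>C\<^sup>2\<^sup>,\<^sup>1\<close> on \<open>[0,1] \<times> I\<close>, for \<open>I \<subseteq> [0,T]\<close>.\<close>

definition C21 :: "real \<Rightarrow> real set \<Rightarrow> (real \<Rightarrow> real \<Rightarrow> real) \<Rightarrow> bool" where
  "C21 T I u \<longleftrightarrow>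
     C1_x I u \<and> C1_x I (partial_x u) \<and>
     (\<forall>x\<in>{0..1}. \<forall>t\<in>I. (\<lambda>s. u x s) differentiable (at t within {0..T})) \<and>
     continuous_on ({0..1} \<times> I) (\<lambda>(x, t). partial_t T u x t)"

definition square_integrable :: "(real \<Rightarrow> real) \<Rightarrow> bool" where
  "square_integrable f \<longleftrightarrow>
     f \<in> borel_measurable (lebesgue_on {0..1}) \<and>
     integrable (lebesgue_on {0..1}) (\<lambda>x. (f x)\<^sup>2)"

definition kern :: "real ^ 2 \<Rightarrow> real \<Rightarrow> real" where
  "kern \<Theta> x = \<Theta> $ 1 * x + \<Theta> $ 2 * x\<^sup>2"

text \<open>
  The initial function is only assumed square integrable and no compatibility with the boundary
  conditions at \<open>t = 0\<close> is imposed. (Compatibility for all \<open>\<Theta>\<close> would force \<open>y0\<close> to be orthogonal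
  to \<open>x\<close> and \<open>x\<^sup>2\<close>.) Hence the equation and the boundary conditions are required classically
  for \<open>0 < t \<le> T\<close>, and the initial value is attained in \<open>L\<^sup>2(0,1)\<close>.
\<close>

definition state_solution ::
    "real \<Rightarrow> real \<Rightarrow> (real \<Rightarrow> real) \<Rightarrow> real ^ 2 \<Rightarrow> (real \<Rightarrow> real \<Rightarrow> real) \<Rightarrow> bool" where
  "state_solution c T y0 \<Theta> y \<longleftrightarrow>
     C21 T {0<..T} y \<and>
     (\<forall>x\<in>{0..1}. \<forall>t\<in>{0<..T}.
        partial_t T y x t = partial_x (partial_x y) x t + c * y x t) \<and>
     (\<forall>x\<in>{0..1}. y x 0 = y0 x) \<and>
     ((\<lambda>t. integral {0..1} (\<lambda>x. (y x t - y0 x)\<^sup>2)) \<longlongrightarrow> 0) (at_right 0) \<and>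
     (\<forall>t\<in>{0<..T}. y 0 t = 0) \<and>
     (\<forall>t\<in>{0<..T}. y 1 t = integral {0..1} (\<lambda>\<xi>. kern \<Theta> \<xi> * y \<xi> t))"

text \<open>
  The source \<open>y\<close> is rough at \<open>t = 0\<close>, and at the corner \<open>(1,T)\<close> it is in general incompatible
  with the zero data, so \<open>v\<^sub>t\<close> and \<open>v\<^sub>x\<^sub>x\<close> are only required to exist for \<open>0 < t < T\<close>, whereas \<open>v\<close> and
  \<open>v\<^sub>x\<close> are continuous on the closed rectangle.
\<close>

definition costate_solution ::
    "real \<Rightarrow> real \<Rightarrow> (real \<Rightarrow> real \<Rightarrow> real) \<Rightarrow> real ^ 2 \<Rightarrow> (real \<Rightarrow> real \<Rightarrow> real) \<Rightarrow> bool" where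
  "costate_solution c T y \<Theta> v \<longleftrightarrow>
     C1_x {0..T} v \<and> C21 T {0<..<T} v \<and>
     (\<forall>x\<in>{0..1}. \<forall>t\<in>{0<..<T}.
        partial_t T v x t + partial_x (partial_x v) x t + c * v x t + y x t
          - kern \<Theta> x * partial_x v 1 t = 0) \<and>
     (\<forall>t\<in>{0..T}. v 0 t = 0 \<and> v 1 t = 0) \<and>
     (\<forall>x\<in>{0..1}. v x T = 0)"

definition cost :: "real \<Rightarrow> (real ^ 2 \<Rightarrow> real \<Rightarrow> real \<Rightarrow> real) \<Rightarrow> real ^ 2 \<Rightarrow> real" where
  "cost T y \<Theta> =
     1 / 2 * integral {0..T} (\<lambda>t. integral {0..1} (\<lambda>x. (y \<Theta> x t)\<^sup>2)) +
     1 / 2 * integral {0..1} (\<lambda>x. (kern \<Theta> x)\<^sup>2)"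

end

theory Submission
  imports Defs
begin

text \<open>
  The gradient formula is an adjoint identity together with an error estimate.

  Fix \<open>\<Theta>\<close>, let \<open>\<Theta>'\<close> be a nearby parameter with kernel \<open>k'\<close> and state \<open>y'\<close>, and put
  \<open>w = y' - y\<close>. Then \<open>w\<close> solves the heat equation with initial value zero, \<open>w(0,t) = 0\<close> and
  \<open>w(1,t) = \<integral> k w + \<integral> (k' - k) y'\<close>. Differentiating \<open>\<integral> v w dx\<close> in time and integrating by parts,
  all terms cancel except \<open>- v\<^sub>x(1,t) \<integral> (k' - k) y' - \<integral> y w\<close>. Since \<open>\<integral> v w\<close> vanishes at both ends of
  the time interval (\<open>adjoint_identity\<close>),
  \<open>\<integral>\<integral> y w = - \<integral> v\<^sub>x(1,t) \<integral> (k' - k) y'\<close>.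
  This identity is exact. With \<open>y'\<^sup>2 = y\<^sup>2 + 2 y w + w\<^sup>2\<close> it shows that the cost differs from its proposed
  linearisation by terms containing \<open>(k' - k) w\<close>, \<open>w\<^sup>2\<close> or \<open>(k' - k)\<^sup>2\<close> (\<open>cost_expansion\<close>).

  It remains to see that the space-time integral of \<open>w\<^sup>2\<close> is \<open>O(\<bar>\<Theta>' - \<Theta>\<bar>\<^sup>2)\<close> (\<open>state_Lipschitz\<close>). The
  boundary value \<open>w(1,t)\<close> depends on \<open>w\<close> itself with a kernel of arbitrary size, and \<open>w\<^sub>x(1,t)\<close> is
  not controlled near \<open>t = 0\<close>. Therefore the energy is measured in \<open>H\<^sup>-\<^sup>1\<close>, by the square integral
  of the mean-zero antiderivative \<open>p\<close> of \<open>- w\<close>. This energy dissipates \<open>2 \<integral> w\<^sup>2\<close> and sees the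
  boundary only through \<open>p(1) w(1)\<close> (\<open>DERIV_dual_energy\<close>). As \<open>p(1)\<close> is of lower order than the
  \<open>L\<^sup>2\<close> norm of \<open>w\<close>, the boundary term is absorbed for kernels of any size, and Gronwall's inequality
  applies (\<open>nonlocal_heat_stability\<close>).

  Both the heat equation and its boundary conditions are available only for \<open>t > 0\<close>, so energies and
  pairings are differentiated on the open time interval and extended continuously to \<open>t = 0\<close> by
  the \<open>L\<^sup>2\<close> convergence to the initial value.
\<close>

section \<open>Integrals over the space interval\<close>

lemma continuous_on_slice:
  fixes u :: "'a::topological_space \<Rightarrow> 'b::topological_space \<Rightarrow> 'c::topological_space"
  assumes "continuous_on (S \<times> I) (\<lambda>(x, t). u x t)" and "t \<in> I"
  shows "continuous_on S (\<lambda>x. u x t)"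
proof -
  have "continuous_on S (\<lambda>x. case (x, t) of (x, t) \<Rightarrow> u x t)"
    using assms by (intro continuous_on_compose2[OF assms(1)]) (auto intro!: continuous_intros)
  then show ?thesis by simp
qed

lemma continuous_on_space_integral:
  fixes u :: "real \<Rightarrow> 'a::topological_space \<Rightarrow> real"
  assumes "continuous_on ({a..b} \<times> I) (\<lambda>(x, t). u x t)"
  shows "continuous_on I (\<lambda>t. integral {a..b} (\<lambda>x. u x t))"
proof -
  have "continuous_on (I \<times> cbox a b) (\<lambda>(t, x). u x t)"
    using continuous_on_swap_args[OF assms] by simp
  then show ?thesis
    using integral_continuous_on_param[of I a b "\<lambda>t x. u x t"] by simp
qed

lemma DERIV_space_integral:
  fixes u ut :: "real \<Rightarrow> real \<Rightarrow> real"
  assumes der: "\<And>x t. x \<in> {a..b} \<Longrightarrow> t \<in> I \<Longrightarrow>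
      ((\<lambda>s. u x s) has_real_derivative ut x t) (at t)"
    and cu: "\<And>t. t \<in> I \<Longrightarrow> continuous_on {a..b} (\<lambda>x. u x t)"
    and cut: "continuous_on ({a..b} \<times> I) (\<lambda>(x, t). ut x t)"
    and I: "open I" "convex I" "t \<in> I"
  shows "((\<lambda>t. integral {a..b} (\<lambda>x. u x t)) has_real_derivative
      integral {a..b} (\<lambda>x. ut x t)) (at t)"
proof -
  have "continuous_on (I \<times> cbox a b) (\<lambda>(t, x). ut x t)"
    using continuous_on_swap_args[OF cut] by simp
  moreover have "(\<lambda>x. u x s) integrable_on cbox a b" if "s \<in> I" for s
    using cu[OF that] by (simp add: integrable_continuous_real)
  moreover have "((\<lambda>s. u x s) has_real_derivative ut x s) (at s within I)"
    if "s \<in> I" "x \<in> cbox a b" for s x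
    using der[of x s] that has_field_derivative_at_within by (metis interval_cbox)
  ultimately have "((\<lambda>t. integral (cbox a b) (\<lambda>x. u x t)) has_real_derivative
      integral (cbox a b) (\<lambda>x. ut x t)) (at t within I)"
    using leibniz_rule_field_derivative[of I a b "\<lambda>t x. u x t" "\<lambda>t x. ut x t" t] I by blast
  then show ?thesis
    using I at_within_open by (metis interval_cbox)
qed

text \<open>
  The substitution \<open>\<xi> = x r\<close> moves \<open>x\<close> from the limit of integration into the integrand, so that
  continuity of an integral with fixed limits in a parameter applies.
\<close>

lemma continuous_on_antiderivative:
  fixes f :: "real \<Rightarrow> 'a::topological_space \<Rightarrow> real"
  assumes f: "continuous_on ({0..1} \<times> I) (\<lambda>(x, t). f x t)"
  shows "continuous_on ({0..1} \<times> I) (\<lambda>(x, t). integral {0..x} (\<lambda>\<xi>. f \<xi> t))"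
proof -
  have scale: "integral {0..x} (\<lambda>\<xi>. f \<xi> t) = x * integral {0..1} (\<lambda>r. f (x * r) t)"
    if x: "x \<in> {0..1}" and t: "t \<in> I" for x t
  proof -
    have c: "continuous_on {0..1} (\<lambda>\<xi>. f \<xi> t)"
      using continuous_on_slice[OF f t] .
    have "((\<lambda>r. x *\<^sub>R f (x * r) t) has_integral
        integral {x * 0..x * 1} (\<lambda>\<xi>. f \<xi> t)) {0..1}"
    proof (rule has_integral_substitution[where c = 0 and d = 1])
      show "continuous_on {0..1} (\<lambda>\<xi>. f \<xi> t)" by (rule c)
      show "(*) x ` {0..1} \<subseteq> {0..1}" using x by (auto intro: mult_le_one)
      show "((*) x has_real_derivative x) (at r within {0..1})" for r
        by (auto intro!: derivative_eq_intros)
    qed (use x in auto)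
    then have "((\<lambda>r. x * f (x * r) t) has_integral integral {0..x} (\<lambda>\<xi>. f \<xi> t)) {0..1}"
      by simp
    then have "integral {0..x} (\<lambda>\<xi>. f \<xi> t) = integral {0..1} (\<lambda>r. x * f (x * r) t)"
      by (rule integral_unique[symmetric])
    then show ?thesis by simp
  qed
  have "continuous_on ({0..1} \<times> ({0..1} \<times> I)) (\<lambda>(r, p). f (fst p * r) (snd p))"
    unfolding split_beta
    by (rule continuous_on_compose2[OF f, of _ "\<lambda>z. (fst (snd z) * fst z, snd (snd z))", simplified])
      (auto intro!: continuous_intros mult_le_one)
  then have "continuous_on ({0..1} \<times> I) (\<lambda>p. integral {0..1} (\<lambda>r. f (fst p * r) (snd p)))"
    by (rule continuous_on_space_integral)
  then have "continuous_on ({0..1} \<times> I)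
      (\<lambda>p. fst p * integral {0..1} (\<lambda>r. f (fst p * r) (snd p)))"
    by (intro continuous_intros)
  then show ?thesis
    by (rule continuous_on_eq) (auto simp: scale)
qed

lemma integral_derivative:
  fixes F f :: "real \<Rightarrow> real"
  assumes "a \<le> b"
    and "\<And>x. x \<in> {a..b} \<Longrightarrow> (F has_real_derivative f x) (at x within {a..b})"
  shows "integral {a..b} f = F b - F a"
  using fundamental_theorem_of_calculus[of a b F f] assms
  by (simp add: has_real_derivative_iff_has_vector_derivative integral_unique)

lemma Cauchy_Schwarz_integral:
  fixes f g :: "real \<Rightarrow> real"
  assumes f: "continuous_on {a..b} f" and g: "continuous_on {a..b} g"
  shows "(integral {a..b} (\<lambda>x. f x * g x))\<^sup>2
    \<le> integral {a..b} (\<lambda>x. (f x)\<^sup>2) * integral {a..b} (\<lambda>x. (g x)\<^sup>2)"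
proof -
  define F where "F = integral {a..b} (\<lambda>x. (f x)\<^sup>2)"
  define G where "G = integral {a..b} (\<lambda>x. (g x)\<^sup>2)"
  define P where "P = integral {a..b} (\<lambda>x. f x * g x)"
  have quad: "0 \<le> r\<^sup>2 * F - 2 * r * s * P + s\<^sup>2 * G" for r s
  proof -
    have "0 \<le> integral {a..b} (\<lambda>x. (r * f x - s * g x)\<^sup>2)"
      by (intro integral_nonneg integrable_continuous_real continuous_intros f g) simp
    also have "\<dots> = integral {a..b} (\<lambda>x. r\<^sup>2 * (f x)\<^sup>2 - 2 * r * s * (f x * g x) + s\<^sup>2 * (g x)\<^sup>2)"
      by (simp add: power2_eq_square algebra_simps)
    also have "\<dots> = r\<^sup>2 * F - 2 * r * s * P + s\<^sup>2 * G"
      unfolding F_def G_def P_def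
      by (subst integral_add integral_diff integral_mult_right,
          (intro integrable_continuous_real continuous_intros f g)+)+ simp
    finally show ?thesis .
  qed
  have "F \<ge> 0" "G \<ge> 0"
    unfolding F_def G_def
    by (intro integral_nonneg integrable_continuous_real continuous_intros f g; simp)+
  show ?thesis
  proof (cases "G = 0")
    case True
    \<comment> \<open>For \<open>G = 0\<close> the quadratic form is affine in \<open>s\<close>; this \<open>s\<close> gives it the value \<open>-1\<close>.\<close>
    have "P = 0"
    proof (rule ccontr)
      assume "P \<noteq> 0"
      then show False
        using quad[of 1 "(F + 1) / (2 * P)"] True by simp
    qed
    then show ?thesis using True by (simp add: F_def G_def P_def)
  next
    case False
    then have "G > 0" using \<open>G \<ge> 0\<close> by simp
    \<comment> \<open>The minimiser, scaled by \<open>G\<close>.\<close>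
    have "0 \<le> G * (F * G - P\<^sup>2)"
      using quad[of G P] by (simp add: power2_eq_square algebra_simps)
    then show ?thesis
      using \<open>G > 0\<close> by (simp add: zero_le_mult_iff F_def G_def P_def)
  qed
qed

lemma integrable_bounded_continuous:
  fixes f :: "real \<Rightarrow> real"
  assumes "continuous_on {a<..<b} f" and "\<And>t. t \<in> {a<..<b} \<Longrightarrow> \<bar>f t\<bar> \<le> B"
  shows "f integrable_on {a..b}"
proof -
  have "f integrable_on {a<..<b}"
  proof (rule measurable_bounded_by_integrable_imp_integrable_real)
    show "f \<in> borel_measurable (lebesgue_on {a<..<b})"
      using assms(1) by (intro continuous_imp_measurable_on_sets_lebesgue) auto
    show "(\<lambda>_. B) integrable_on {a<..<b}"
      by (simp add: integrable_on_open_interval_real integrable_const_ivl)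
  qed (use assms(2) in auto)
  then show ?thesis by (simp add: integrable_on_open_interval_real)
qed

section \<open>The pairing of state and costate\<close>

text \<open>
  A function with its derivatives kept as explicit data. This makes differences of solutions
  immediate, and with an open time set all time derivatives are two-sided.
\<close>

locale parabolic_regular =
  fixes I :: "real set" and u ux uxx ut :: "real \<Rightarrow> real \<Rightarrow> real"
  assumes open_I: "open I" and convex_I: "convex I"
    and der_x: "\<And>x t. x \<in> {0..1} \<Longrightarrow> t \<in> I \<Longrightarrow>
      ((\<lambda>\<xi>. u \<xi> t) has_real_derivative ux x t) (at x within {0..1})"
    and der_xx: "\<And>x t. x \<in> {0..1} \<Longrightarrow> t \<in> I \<Longrightarrow>
      ((\<lambda>\<xi>. ux \<xi> t) has_real_derivative uxx x t) (at x within {0..1})"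
    and der_t: "\<And>x t. x \<in> {0..1} \<Longrightarrow> t \<in> I \<Longrightarrow>
      ((\<lambda>s. u x s) has_real_derivative ut x t) (at t)"
    and cont: "continuous_on ({0..1} \<times> I) (\<lambda>(x, t). u x t)"
    and cont_x: "continuous_on ({0..1} \<times> I) (\<lambda>(x, t). ux x t)"
    and cont_xx: "continuous_on ({0..1} \<times> I) (\<lambda>(x, t). uxx x t)"
    and cont_t: "continuous_on ({0..1} \<times> I) (\<lambda>(x, t). ut x t)"
begin

lemmas slice = continuous_on_slice[OF cont] and slice_x = continuous_on_slice[OF cont_x]
  and slice_xx = continuous_on_slice[OF cont_xx] and slice_t = continuous_on_slice[OF cont_t]

end

lemma parabolic_regular_diff:
  assumes "parabolic_regular I u ux uxx ut" and "parabolic_regular I v vx vxx vt"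
  shows "parabolic_regular I (\<lambda>x t. u x t - v x t) (\<lambda>x t. ux x t - vx x t)
    (\<lambda>x t. uxx x t - vxx x t) (\<lambda>x t. ut x t - vt x t)"
proof -
  interpret u: parabolic_regular I u ux uxx ut by fact
  interpret v: parabolic_regular I v vx vxx vt by fact
  show ?thesis
  proof
    show "continuous_on ({0..1} \<times> I) (\<lambda>(x, t). u x t - v x t)"
      using continuous_on_diff[OF u.cont v.cont] by (simp add: split_def)
    show "continuous_on ({0..1} \<times> I) (\<lambda>(x, t). ux x t - vx x t)"
      using continuous_on_diff[OF u.cont_x v.cont_x] by (simp add: split_def)
    show "continuous_on ({0..1} \<times> I) (\<lambda>(x, t). uxx x t - vxx x t)"
      using continuous_on_diff[OF u.cont_xx v.cont_xx] by (simp add: split_def)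
    show "continuous_on ({0..1} \<times> I) (\<lambda>(x, t). ut x t - vt x t)"
      using continuous_on_diff[OF u.cont_t v.cont_t] by (simp add: split_def)
  qed (intro u.open_I u.convex_I DERIV_diff u.der_x v.der_x u.der_xx v.der_xx u.der_t v.der_t;
      assumption)+
qed

text \<open>
  Since \<open>v\<close> solves the backward adjoint equation, the zero-order terms cancel and integration by
  parts in \<open>x\<close> leaves only boundary values. As \<open>v\<close> vanishes at both ends, the only surviving one
  is \<open>v\<^sub>x(1) w(1)\<close>. The nonlocal term of the costate equation is there to cancel the part of
  \<open>w(1)\<close> produced by the kernel \<open>k\<close>.
\<close>

lemma DERIV_duality_pairing:
  assumes "parabolic_regular I w wx wxx wt" and "parabolic_regular I v vx vxx vt" and t: "t \<in> I"
    and w_eq: "\<And>x. x \<in> {0..1} \<Longrightarrow> wt x t = wxx x t + c * w x t"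
    and v_eq: "\<And>x. x \<in> {0..1} \<Longrightarrow>
      vt x t + vxx x t + c * v x t + f x - k x * vx 1 t = 0"
    and bc: "w 0 t = 0" "v 0 t = 0" "v 1 t = 0"
    and f: "continuous_on {0..1} f" and k: "continuous_on {0..1} k"
  shows "((\<lambda>t. integral {0..1} (\<lambda>x. v x t * w x t)) has_real_derivative
      - vx 1 t * (w 1 t - integral {0..1} (\<lambda>x. k x * w x t))
        - integral {0..1} (\<lambda>x. f x * w x t)) (at t)"
proof -
  interpret w: parabolic_regular I w wx wxx wt by fact
  interpret v: parabolic_regular I v vx vxx vt by fact
  note slices = w.slice[OF t] w.slice_x[OF t] w.slice_xx[OF t] w.slice_t[OF t]
    v.slice[OF t] v.slice_x[OF t] v.slice_xx[OF t] v.slice_t[OF t] f k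
  have der: "((\<lambda>t. integral {0..1} (\<lambda>x. v x t * w x t)) has_real_derivative
      integral {0..1} (\<lambda>x. vt x t * w x t + wt x t * v x t)) (at t)"
  proof (rule DERIV_space_integral)
    show "((\<lambda>s. v x s * w x s) has_real_derivative vt x s * w x s + wt x s * v x s) (at s)"
      if "x \<in> {0..1}" "s \<in> I" for x s
      using that by (intro DERIV_mult v.der_t w.der_t)
    show "continuous_on {0..1} (\<lambda>x. v x s * w x s)" if "s \<in> I" for s
      by (intro continuous_on_mult v.slice w.slice that)
    show "continuous_on ({0..1} \<times> I) (\<lambda>(x, t). vt x t * w x t + wt x t * v x t)"
      using continuous_on_add[OF continuous_on_mult[OF v.cont_t w.cont]
          continuous_on_mult[OF w.cont_t v.cont]]
      by (simp add: split_def)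
  qed (use t v.open_I v.convex_I in auto)
  have "integral {0..1} (\<lambda>x. vt x t * w x t + wt x t * v x t)
      = integral {0..1} (\<lambda>x. (v x t * wxx x t - vxx x t * w x t)
          - f x * w x t + vx 1 t * (k x * w x t))"
  proof (rule integral_cong)
    fix x :: real assume x: "x \<in> {0..1}"
    have "vt x t = - vxx x t - c * v x t - f x + k x * vx 1 t"
      using v_eq[OF x] by linarith
    then show "vt x t * w x t + wt x t * v x t
      = (v x t * wxx x t - vxx x t * w x t) - f x * w x t + vx 1 t * (k x * w x t)"
      by (simp only: w_eq[OF x]) (simp add: algebra_simps)
  qed
  also have "\<dots> = integral {0..1} (\<lambda>x. v x t * wxx x t - vxx x t * w x t)
      - integral {0..1} (\<lambda>x. f x * w x t) + vx 1 t * integral {0..1} (\<lambda>x. k x * w x t)"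
    by (subst integral_add integral_diff,
        (intro integrable_continuous_real continuous_intros slices)+)+ simp
  also have "integral {0..1} (\<lambda>x. v x t * wxx x t - vxx x t * w x t) = - vx 1 t * w 1 t"
  proof -
    have "((\<lambda>x. v x t * wx x t - vx x t * w x t) has_real_derivative
        v x t * wxx x t - vxx x t * w x t) (at x within {0..1})" if "x \<in> {0..1}" for x
      using DERIV_diff[OF DERIV_mult[OF v.der_x w.der_xx] DERIV_mult[OF v.der_xx w.der_x],
          OF that t that t that t that t]
      by (simp add: algebra_simps)
    then show ?thesis using bc by (subst integral_derivative) auto
  qed
  finally have "integral {0..1} (\<lambda>x. vt x t * w x t + wt x t * v x t)
    = - vx 1 t * (w 1 t - integral {0..1} (\<lambda>x. k x * w x t)) - integral {0..1} (\<lambda>x. f x * w x t)"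
    by (simp add: algebra_simps)
  with der show ?thesis by simp
qed

section \<open>A negative-order energy\<close>

text \<open>
  This is \<open>\<phi>'\<close> for the solution of \<open>- \<phi>'' = g\<close>, \<open>\<phi>(0) = \<phi>(1) = 0\<close>; the condition \<open>\<phi>(1) = 0\<close> says
  that the mean of \<open>\<phi>'\<close> vanishes, which fixes the constant of integration.
\<close>

definition mean_zero_antiderivative :: "(real \<Rightarrow> real) \<Rightarrow> real \<Rightarrow> real" where
  "mean_zero_antiderivative g x = integral {0..1} (\<lambda>\<xi>. (1 - \<xi>) * g \<xi>) - integral {0..x} g"

text \<open>The square of the \<open>H\<^sup>-\<^sup>1\<close> norm of \<open>g\<close>, namely \<open>\<integral> (\<phi>')\<^sup>2 = \<integral> g \<phi>\<close>.\<close>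

definition dual_energy :: "(real \<Rightarrow> real) \<Rightarrow> real" where
  "dual_energy g = integral {0..1} (\<lambda>x. (mean_zero_antiderivative g x)\<^sup>2)"

lemma mean_zero_antiderivative_deriv:
  assumes "continuous_on {0..1} g" and "x \<in> {0..1}"
  shows "(mean_zero_antiderivative g has_real_derivative - g x) (at x within {0..1})"
proof -
  have "((\<lambda>x. integral {0..x} g) has_real_derivative g x) (at x within {0..1})"
    unfolding has_real_derivative_iff_has_vector_derivative
    by (rule integral_has_vector_derivative[OF assms])
  from DERIV_diff[OF DERIV_const this] show ?thesis
    by (simp add: mean_zero_antiderivative_def[abs_def])
qed

lemma continuous_on_mean_zero_antiderivative:
  assumes "continuous_on {0..1} g"
  shows "continuous_on {0..1} (mean_zero_antiderivative g)"
  by (rule DERIV_continuous_on[OF mean_zero_antiderivative_deriv[OF assms]])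

lemma integral_mean_zero_antiderivative:
  assumes g: "continuous_on {0..1} g"
  shows "integral {0..1} (mean_zero_antiderivative g) = 0"
proof -
  let ?p = "mean_zero_antiderivative g"
  have "((\<lambda>x. x * ?p x) has_real_derivative ?p x - x * g x) (at x within {0..1})"
    if "x \<in> {0..1}" for x
    using DERIV_mult[OF DERIV_ident mean_zero_antiderivative_deriv[OF g that]]
    by (simp add: mult.commute)
  then have "integral {0..1} (\<lambda>x. ?p x - x * g x) = ?p 1"
    by (subst integral_derivative) auto
  moreover have "integral {0..1} (\<lambda>x. ?p x - x * g x)
      = integral {0..1} ?p - integral {0..1} (\<lambda>x. x * g x)"
    by (intro integral_diff integrable_continuous_real continuous_intros g
        continuous_on_mean_zero_antiderivative)
  moreover have "integral {0..1} (\<lambda>x. (1 - x) * g x)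
      = integral {0..1} g - integral {0..1} (\<lambda>x. x * g x)"
    by (subst integral_diff[symmetric])
      (auto intro!: integrable_continuous_real continuous_intros g simp: algebra_simps)
  ultimately show ?thesis
    by (simp add: mean_zero_antiderivative_def)
qed

lemma dual_energy_nonneg:
  assumes "continuous_on {0..1} g"
  shows "0 \<le> dual_energy g"
  unfolding dual_energy_def
  by (intro integral_nonneg integrable_continuous_real continuous_intros
      continuous_on_mean_zero_antiderivative assms) simp

text \<open>
  An interpolation inequality for \<open>p\<close> with \<open>p' = - g\<close>, from \<open>p(1)\<^sup>2 = \<integral> (x p\<^sup>2)'\<close>. Its point is that the
  coefficient of \<open>\<integral> g\<^sup>2\<close> can be made as small as needed, at the price of a large multiple of the
  energy.
\<close>

lemma mean_zero_antiderivative_at_1_bound: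
  assumes g: "continuous_on {0..1} g" and l: "l > 0"
  shows "(mean_zero_antiderivative g 1)\<^sup>2
    \<le> (1 + l) * dual_energy g + integral {0..1} (\<lambda>x. (g x)\<^sup>2) / l"
proof -
  let ?p = "mean_zero_antiderivative g"
  note p = continuous_on_mean_zero_antiderivative[OF g]
  have "((\<lambda>x. x * (?p x)\<^sup>2) has_real_derivative (?p x)\<^sup>2 - 2 * x * ?p x * g x) (at x within {0..1})"
    if "x \<in> {0..1}" for x
    using DERIV_mult[OF DERIV_ident DERIV_power[OF mean_zero_antiderivative_deriv[OF g that], of 2]]
    by (simp add: algebra_simps)
  then have "(?p 1)\<^sup>2 = integral {0..1} (\<lambda>x. (?p x)\<^sup>2 - 2 * x * ?p x * g x)"
    by (subst integral_derivative) auto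
  also have "\<dots> \<le> integral {0..1} (\<lambda>x. (1 + l) * (?p x)\<^sup>2 + (g x)\<^sup>2 / l)"
  proof (rule integral_le)
    fix x :: real assume x: "x \<in> {0..1}"
    have "0 \<le> (l * ?p x + x * g x)\<^sup>2 / l"
      using l by simp
    also have "\<dots> = l * (?p x)\<^sup>2 + 2 * x * ?p x * g x + x\<^sup>2 * (g x)\<^sup>2 / l"
      using l by (simp add: power2_eq_square field_simps)
    also have "x\<^sup>2 * (g x)\<^sup>2 / l \<le> (g x)\<^sup>2 / l"
      using x l by (intro divide_right_mono mult_left_le_one_le) (auto simp: power_le_one)
    finally show "(?p x)\<^sup>2 - 2 * x * ?p x * g x \<le> (1 + l) * (?p x)\<^sup>2 + (g x)\<^sup>2 / l"
      by (simp add: algebra_simps)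
  qed (use l in \<open>intro integrable_continuous_real continuous_intros g p; simp\<close>)+
  also have "\<dots> = (1 + l) * dual_energy g + integral {0..1} (\<lambda>x. (g x)\<^sup>2) / l"
    unfolding dual_energy_def using l
    by (subst integral_add) (auto intro!: integrable_continuous_real continuous_intros g p)
  finally show ?thesis .
qed

text \<open>
  The constant is not sharp; the bound serves to pass the vanishing of the initial value from the
  \<open>L\<^sup>2\<close> norm to the energy.
\<close>

lemma dual_energy_le:
  assumes g: "continuous_on {0..1} g"
  shows "dual_energy g \<le> 4 * integral {0..1} (\<lambda>x. (g x)\<^sup>2)"
proof -
  let ?p = "mean_zero_antiderivative g" and ?N = "integral {0..1} (\<lambda>x. (g x)\<^sup>2)"
  note p = continuous_on_mean_zero_antiderivative[OF g]
  have N: "?N \<ge> 0"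
    by (intro integral_nonneg integrable_continuous_real continuous_intros g) simp
  have "(?p x)\<^sup>2 \<le> 4 * ?N" if x: "x \<in> {0..1}" for x
  proof -
    have gx: "continuous_on {0..x} g"
      using g x by (auto intro: continuous_on_subset)
    have "(integral {0..1} (\<lambda>\<xi>. (1 - \<xi>) * g \<xi>))\<^sup>2
        \<le> integral {0..1} (\<lambda>\<xi>. (1 - \<xi>)\<^sup>2) * ?N"
      by (intro Cauchy_Schwarz_integral continuous_intros g)
    also have "\<dots> \<le> integral {0..1} (\<lambda>\<xi>::real. 1) * ?N"
      by (intro mult_right_mono integral_le N integrable_continuous_real continuous_intros)
        (auto simp: power_le_one)
    finally have 1: "(integral {0..1} (\<lambda>\<xi>. (1 - \<xi>) * g \<xi>))\<^sup>2 \<le> ?N" by simp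
    have "(integral {0..x} (\<lambda>\<xi>. 1 * g \<xi>))\<^sup>2
        \<le> integral {0..x} (\<lambda>\<xi>. 1\<^sup>2) * integral {0..x} (\<lambda>x. (g x)\<^sup>2)"
      by (intro Cauchy_Schwarz_integral continuous_intros gx)
    also have "\<dots> \<le> 1 * ?N"
      using x by (intro mult_mono integral_subset_le integral_nonneg integrable_continuous_real
          continuous_intros g gx) auto
    finally have 2: "(integral {0..x} g)\<^sup>2 \<le> ?N" by simp
    have "(a - b)\<^sup>2 \<le> 2 * a\<^sup>2 + 2 * b\<^sup>2" for a b :: real
      using zero_le_power2[of "a + b"] by (simp add: power2_eq_square algebra_simps)
    from this[of "integral {0..1} (\<lambda>\<xi>. (1 - \<xi>) * g \<xi>)" "integral {0..x} g"] show ?thesis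
      using 1 2 unfolding mean_zero_antiderivative_def by linarith
  qed
  then have "dual_energy g \<le> integral {0..1} (\<lambda>x::real. 4 * ?N)"
    unfolding dual_energy_def
    by (intro integral_le integrable_continuous_real continuous_intros p) auto
  then show ?thesis by simp
qed

lemma continuous_on_mean_zero_antiderivative_joint:
  fixes f :: "real \<Rightarrow> real \<Rightarrow> real"
  assumes f: "continuous_on ({0..1} \<times> I) (\<lambda>(x, t). f x t)"
  shows "continuous_on ({0..1} \<times> I) (\<lambda>(x, t). mean_zero_antiderivative (\<lambda>\<xi>. f \<xi> t) x)"
proof -
  have "continuous_on ({0..1} \<times> I) (\<lambda>p. (1 - fst p) * (\<lambda>(x, t). f x t) p)"
    by (intro continuous_intros f)
  then have "continuous_on ({0..1} \<times> I) (\<lambda>(x, t). (1 - x) * f x t)"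
    by (simp add: split_def)
  then have "continuous_on I (\<lambda>t. integral {0..1} (\<lambda>\<xi>. (1 - \<xi>) * f \<xi> t))"
    by (rule continuous_on_space_integral)
  then have "continuous_on ({0..1::real} \<times> I) (\<lambda>p. integral {0..1} (\<lambda>\<xi>. (1 - \<xi>) * f \<xi> (snd p)))"
    by (rule continuous_on_compose2) (auto intro!: continuous_intros)
  from continuous_on_diff[OF this continuous_on_antiderivative[OF f]] show ?thesis
    by (simp add: mean_zero_antiderivative_def split_def)
qed

lemma continuous_on_dual_energy:
  fixes f :: "real \<Rightarrow> real \<Rightarrow> real"
  assumes f: "continuous_on ({0..1} \<times> I) (\<lambda>(x, t). f x t)"
  shows "continuous_on I (\<lambda>t. dual_energy (\<lambda>\<xi>. f \<xi> t))"
  unfolding dual_energy_def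
  using continuous_on_power[OF continuous_on_mean_zero_antiderivative_joint[OF f], of 2]
  by (intro continuous_on_space_integral) (simp add: split_def)

text \<open>
  With \<open>p\<close> the mean-zero antiderivative of \<open>w\<close>, the heat equation gives \<open>p\<^sub>t = - w\<^sub>x + c p + \<kappa>\<close> with
  \<open>\<kappa>\<close> independent of \<open>x\<close>. The unknown \<open>\<kappa>\<close>, which contains \<open>w\<^sub>x(0)\<close>, drops out after multiplication
  by \<open>p\<close> because \<open>p\<close> has mean zero, and one integration by parts yields the dissipation term
  \<open>- 2 \<integral> w\<^sup>2\<close>. Only the value \<open>w(1)\<close> enters, neither \<open>w\<^sub>x(1)\<close> nor a time derivative of \<open>w(1)\<close>.
\<close>

lemma DERIV_dual_energy:
  assumes "parabolic_regular I w wx wxx wt" and t: "t \<in> I"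
    and w_eq: "\<And>x. x \<in> {0..1} \<Longrightarrow> wt x t = wxx x t + c * w x t"
    and bc: "w 0 t = 0"
  shows "((\<lambda>t. dual_energy (\<lambda>x. w x t)) has_real_derivative
      2 * c * dual_energy (\<lambda>x. w x t)
        - 2 * mean_zero_antiderivative (\<lambda>x. w x t) 1 * w 1 t
        - 2 * integral {0..1} (\<lambda>x. (w x t)\<^sup>2)) (at t)"
proof -
  interpret w: parabolic_regular I w wx wxx wt by fact
  define p where "p x t = mean_zero_antiderivative (\<lambda>\<xi>. w \<xi> t) x" for x t
  define pt where "pt x t = mean_zero_antiderivative (\<lambda>\<xi>. wt \<xi> t) x" for x t
  have slice_p: "continuous_on {0..1} (\<lambda>x. p x s)" if "s \<in> I" for s
    unfolding p_def by (intro continuous_on_mean_zero_antiderivative w.slice that)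
  have p_t: "((\<lambda>s. p x s) has_real_derivative pt x s) (at s)" if x: "x \<in> {0..1}" and s: "s \<in> I"
    for x s
  proof -
    have sub: "{0..x} \<times> I \<subseteq> {0..1} \<times> I" using x by auto
    have "((\<lambda>s. integral {0..1} (\<lambda>\<xi>. (1 - \<xi>) * w \<xi> s)) has_real_derivative
        integral {0..1} (\<lambda>\<xi>. (1 - \<xi>) * wt \<xi> s)) (at s)"
    proof (rule DERIV_space_integral)
      have "continuous_on ({0..1} \<times> I) (\<lambda>p. (1 - fst p) * (\<lambda>(x, t). wt x t) p)"
        by (intro continuous_intros w.cont_t)
      then show "continuous_on ({0..1} \<times> I) (\<lambda>(x, t). (1 - x) * wt x t)"
        by (simp add: split_def)
    qed (use w.open_I w.convex_I s in
        \<open>auto intro!: DERIV_cmult w.der_t continuous_intros w.slice\<close>)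
    moreover have "((\<lambda>s. integral {0..x} (\<lambda>\<xi>. w \<xi> s)) has_real_derivative
        integral {0..x} (\<lambda>\<xi>. wt \<xi> s)) (at s)"
    proof (rule DERIV_space_integral)
      show "continuous_on {0..x} (\<lambda>x. w x t)" if "t \<in> I" for t
        by (rule continuous_on_subset[OF w.slice[OF that]]) (use x in auto)
      show "continuous_on ({0..x} \<times> I) (\<lambda>(x, t). wt x t)"
        by (rule continuous_on_subset[OF w.cont_t sub])
    qed (use w.open_I w.convex_I s x in \<open>auto intro!: w.der_t\<close>)
    ultimately show ?thesis
      unfolding p_def pt_def mean_zero_antiderivative_def by (rule DERIV_diff)
  qed
  have "((\<lambda>t. integral {0..1} (\<lambda>x. (p x t)\<^sup>2)) has_real_derivative
      integral {0..1} (\<lambda>x. 2 * (p x t * pt x t))) (at t)"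
  proof (rule DERIV_space_integral)
    show "((\<lambda>s. (p x s)\<^sup>2) has_real_derivative 2 * (p x s * pt x s)) (at s)"
      if "x \<in> {0..1}" "s \<in> I" for x s
      using p_t[OF that] by (auto intro!: derivative_eq_intros)
    show "continuous_on {0..1} (\<lambda>x. (p x s)\<^sup>2)" if "s \<in> I" for s
      by (intro continuous_intros slice_p that)
    show "continuous_on ({0..1} \<times> I) (\<lambda>(x, t). 2 * (p x t * pt x t))"
      using continuous_on_mult[OF continuous_on_const[of _ 2] continuous_on_mult[OF
          continuous_on_mean_zero_antiderivative_joint[OF w.cont]
          continuous_on_mean_zero_antiderivative_joint[OF w.cont_t]]]
      unfolding p_def pt_def by (simp add: split_def)
  qed (use w.open_I w.convex_I t in auto)
  moreover have "integral {0..1} (\<lambda>x. 2 * (p x t * pt x t))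
      = 2 * c * dual_energy (\<lambda>x. w x t) - 2 * p 1 t * w 1 t - 2 * integral {0..1} (\<lambda>x. (w x t)\<^sup>2)"
  proof -
    define \<kappa> where "\<kappa> = integral {0..1} (\<lambda>\<xi>. (1 - \<xi>) * wt \<xi> t) + wx 0 t
      - c * integral {0..1} (\<lambda>\<xi>. (1 - \<xi>) * w \<xi> t)"
    note cs = w.slice[OF t] w.slice_x[OF t] w.slice_xx[OF t] w.slice_t[OF t] slice_p[OF t]
    have pt_eq: "pt x t = \<kappa> + c * p x t - wx x t" if x: "x \<in> {0..1}" for x
    proof -
      have sub: "{0..x} \<subseteq> {0..1}" using x by auto
      note cs' = cs[THEN continuous_on_subset, OF sub]
      have xx: "integral {0..x} (\<lambda>x. wxx x t) = wx x t - wx 0 t"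
      proof (rule integral_derivative)
        fix z assume "z \<in> {0..x}"
        then have "((\<lambda>x. wx x t) has_real_derivative wxx z t) (at z within {0..1})"
          using w.der_xx[of z t] x t by auto
        then show "((\<lambda>x. wx x t) has_real_derivative wxx z t) (at z within {0..x})"
          using sub by (rule has_field_derivative_subset)
      qed (use x in auto)
      have "integral {0..x} (\<lambda>\<xi>. wt \<xi> t) = integral {0..x} (\<lambda>\<xi>. wxx \<xi> t + c * w \<xi> t)"
        using sub w_eq by (intro integral_cong) auto
      also have "\<dots> = wx x t - wx 0 t + c * integral {0..x} (\<lambda>\<xi>. w \<xi> t)"
        by (subst integral_add) (auto intro!: integrable_continuous_real continuous_intros cs' simp: xx)
      finally show ?thesis
        by (simp add: pt_def p_def mean_zero_antiderivative_def \<kappa>_def algebra_simps)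
    qed
    have "((\<lambda>x. p x t * w x t) has_real_derivative p x t * wx x t - (w x t)\<^sup>2) (at x within {0..1})"
      if "x \<in> {0..1}" for x
      using DERIV_mult[OF mean_zero_antiderivative_deriv[OF w.slice[OF t] that] w.der_x[OF that t]]
      unfolding p_def by (simp add: algebra_simps power2_eq_square)
    then have "p 1 t * w 1 t = integral {0..1} (\<lambda>x. p x t * wx x t - (w x t)\<^sup>2)"
      using bc by (subst integral_derivative) auto
    also have "\<dots> = integral {0..1} (\<lambda>x. p x t * wx x t) - integral {0..1} (\<lambda>x. (w x t)\<^sup>2)"
      by (intro integral_diff integrable_continuous_real continuous_intros cs)
    finally have ibp: "integral {0..1} (\<lambda>x. p x t * wx x t)
        = p 1 t * w 1 t + integral {0..1} (\<lambda>x. (w x t)\<^sup>2)" by simp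
    have mean: "integral {0..1} (\<lambda>x. p x t) = 0"
      using integral_mean_zero_antiderivative[OF w.slice[OF t]]
      unfolding p_def by simp
    have "integral {0..1} (\<lambda>x. 2 * (p x t * pt x t))
        = integral {0..1} (\<lambda>x. 2 * \<kappa> * p x t + 2 * c * (p x t)\<^sup>2 - 2 * (p x t * wx x t))"
      by (intro integral_cong) (simp add: pt_eq power2_eq_square algebra_simps)
    also have "\<dots> = 2 * \<kappa> * integral {0..1} (\<lambda>x. p x t) + 2 * c * integral {0..1} (\<lambda>x. (p x t)\<^sup>2)
        - 2 * integral {0..1} (\<lambda>x. p x t * wx x t)"
      by (subst integral_add integral_diff,
        (intro integrable_continuous_real continuous_intros cs)+)+ simp
    finally show ?thesis
      unfolding mean ibp dual_energy_def by (simp add: p_def)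
  qed
  ultimately show ?thesis
    by (simp add: dual_energy_def p_def)
qed

section \<open>Stability under perturbed nonlocal boundary data\<close>

lemma continuous_on_Icc_from_Ioc:
  fixes g :: "real \<Rightarrow> real"
  assumes g: "continuous_on {a<..b} g" and lim: "(g \<longlongrightarrow> g a) (at_right a)" and "a < b"
  shows "continuous_on {a..b} g"
  unfolding continuous_on
proof
  fix x assume x: "x \<in> {a..b}"
  show "(g \<longlongrightarrow> g x) (at x within {a..b})"
  proof (cases "x = a")
    case True
    then show ?thesis using lim \<open>a < b\<close> by (simp add: at_within_Icc_at_right)
  next
    case False
    then have "at x within {a..b} = at x within {a<..b}"
      using x by (intro at_within_nhd[of x "{a<..}"]) auto
    then show ?thesis using g x False by (simp add: continuous_on)
  qed
qed

text \<open>
  The rate \<open>2 c + M (1 + 2 M)\<close> with \<open>M = 2 K + 4\<close>, the weight used below to split the product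
  \<open>p(1) w(1)\<close>.
\<close>

definition growth_rate :: "real \<Rightarrow> real \<Rightarrow> real" where
  "growth_rate c K = 2 * c + (2 * K + 4) * (1 + 2 * (2 * K + 4))"

text \<open>
  The usual \<open>L\<^sup>2\<close> energy estimate is of no use here, since it involves the uncontrolled flux
  \<open>w\<^sub>x(1)\<close>. The energy \<open>E\<close> of negative order involves \<open>2 p(1) w(1)\<close> instead, which Young's inequality
  bounds by \<open>M p(1)\<^sup>2 + w(1)\<^sup>2 / M\<close>. For large \<open>M\<close> a quarter of the dissipation \<open>2 \<integral> w\<^sup>2\<close> absorbs the
  second summand up to \<open>f\<close>, whatever the size of \<open>K\<close>, and by interpolation another quarter absorbs
  the first up to a multiple of \<open>E\<close>. This leaves \<open>E' \<le> L E + f - \<integral> w\<^sup>2\<close>, and Gronwall's argument with \<open>E(0) = 0\<close>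
  bounds the time integral of the last term.
\<close>

lemma nonlocal_heat_stability:
  assumes reg: "parabolic_regular {0<..<T} w wx wxx wt" and T: "T > 0"
    and w_cont: "continuous_on ({0..1} \<times> {0<..T}) (\<lambda>(x, t). w x t)"
    and w_eq: "\<And>x t. x \<in> {0..1} \<Longrightarrow> t \<in> {0<..<T} \<Longrightarrow> wt x t = wxx x t + c * w x t"
    and bc0: "\<And>t. t \<in> {0<..<T} \<Longrightarrow> w 0 t = 0"
    and bc1: "\<And>t. t \<in> {0<..<T} \<Longrightarrow> (w 1 t)\<^sup>2 \<le> K * integral {0..1} (\<lambda>x. (w x t)\<^sup>2) + f"
    and init: "\<And>x. x \<in> {0..1} \<Longrightarrow> w x 0 = 0"
    and lim: "((\<lambda>t. integral {0..1} (\<lambda>x. (w x t)\<^sup>2)) \<longlongrightarrow> 0) (at_right 0)"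
    and nonneg: "c \<ge> 0" "K \<ge> 0" "f \<ge> 0"
  shows "continuous_on {0..T} (\<lambda>t. integral {0..1} (\<lambda>x. (w x t)\<^sup>2))"
    and "integral {0..T} (\<lambda>t. integral {0..1} (\<lambda>x. (w x t)\<^sup>2)) \<le> T * f * exp (growth_rate c K * T)"
proof -
  interpret w: parabolic_regular "{0<..<T}" w wx wxx wt by fact
  define N where "N t = integral {0..1} (\<lambda>x. (w x t)\<^sup>2)" for t
  define E where "E t = dual_energy (\<lambda>x. w x t)" for t
  define L where "L = growth_rate c K"
  have N0: "N 0 = 0"
    unfolding N_def using init by (subst integral_cong[where g = "\<lambda>_. 0"]) auto
  have slice: "continuous_on {0..1} (\<lambda>x. w x t)" if "t \<in> {0..T}" for t
  proof (cases "t = 0")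
    case True
    then show ?thesis
      using init by (subst continuous_on_cong[where g = "\<lambda>_. 0"]) auto
  next
    case False
    then show ?thesis using that continuous_on_slice[OF w_cont, of t] by auto
  qed
  have N_nonneg: "N t \<ge> 0" if "t \<in> {0..T}" for t
    unfolding N_def
    by (intro integral_nonneg integrable_continuous_real continuous_intros slice that) simp
  show N_cont: "continuous_on {0..T} (\<lambda>t. integral {0..1} (\<lambda>x. (w x t)\<^sup>2))"
  proof (rule continuous_on_Icc_from_Ioc)
    have "continuous_on ({0..1} \<times> {0<..T}) (\<lambda>(x, t). (w x t)\<^sup>2)"
      using continuous_on_power[OF w_cont, of 2] by (simp add: split_def)
    then show "continuous_on {0<..T} (\<lambda>t. integral {0..1} (\<lambda>x. (w x t)\<^sup>2))"
      by (rule continuous_on_space_integral)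
  qed (use T lim N0 in \<open>auto simp: N_def\<close>)
  have E_le: "E t \<le> 4 * N t" and E_nonneg: "0 \<le> E t" if "t \<in> {0..T}" for t
    using dual_energy_le[OF slice[OF that]] dual_energy_nonneg[OF slice[OF that]]
    by (auto simp: E_def N_def)
  have E0: "E 0 = 0"
    using E_le[of 0] E_nonneg[of 0] N0 T by simp
  have E_lim: "(E \<longlongrightarrow> 0) (at_right 0)"
  proof (rule tendsto_sandwich)
    show "\<forall>\<^sub>F t in at_right 0. 0 \<le> E t" "\<forall>\<^sub>F t in at_right 0. E t \<le> 4 * N t"
      using eventually_at_right_real[OF T] by (eventually_elim; use E_nonneg E_le in force)+
    show "((\<lambda>t. 4 * N t) \<longlongrightarrow> 0) (at_right 0)"
      using tendsto_mult_right_zero[OF lim, of 4] by (simp add: N_def)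
  qed simp
  have E_cont: "continuous_on {0..T} E"
    using continuous_on_dual_energy[OF w_cont] E_lim E0 T
    by (intro continuous_on_Icc_from_Ioc) (auto simp: E_def[abs_def])
  define E' where "E' t = 2 * c * E t - 2 * mean_zero_antiderivative (\<lambda>x. w x t) 1 * w 1 t - 2 * N t"
    for t
  have E_deriv: "(E has_real_derivative E' t) (at t)" if t: "t \<in> {0<..<T}" for t
    using DERIV_dual_energy[OF reg t] w_eq[OF _ t] bc0[OF t]
    unfolding E_def[abs_def] E'_def N_def by blast
  have E'_le: "E' t \<le> L * E t + f - N t" if t: "t \<in> {0<..<T}" for t
  proof -
    define p where "p = mean_zero_antiderivative (\<lambda>x. w x t) 1"
    define M where "M = 2 * K + 4"
    have M: "M \<ge> 4" using nonneg by (simp add: M_def)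
    have pos: "N t \<ge> 0" using N_nonneg[of t] t by simp
    have p: "p\<^sup>2 \<le> (1 + 2 * M) * E t + N t / (2 * M)"
      using mean_zero_antiderivative_at_1_bound[of "\<lambda>x. w x t" "2 * M"] slice[of t] t M
      by (simp add: p_def E_def N_def)
    \<comment> \<open>Young with weight \<open>M\<close>; the choice \<open>M = 2 K + 4\<close> gives \<open>K / M \<le> 1 / 2\<close>.\<close>
    have "0 \<le> (M * p + w 1 t)\<^sup>2 / M"
      using M by simp
    also have "\<dots> = M * p\<^sup>2 + 2 * p * w 1 t + (w 1 t)\<^sup>2 / M"
      using M by (simp add: power2_eq_square field_simps)
    finally have "- 2 * p * w 1 t \<le> M * p\<^sup>2 + (w 1 t)\<^sup>2 / M" by simp
    also have "M * p\<^sup>2 \<le> M * ((1 + 2 * M) * E t + N t / (2 * M))"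
      using p M by (intro mult_left_mono) auto
    also have "\<dots> = M * (1 + 2 * M) * E t + N t / 2"
      using M by (simp add: field_simps)
    also have "(w 1 t)\<^sup>2 / M \<le> N t / 2 + f"
    proof -
      have "(w 1 t)\<^sup>2 \<le> K * N t + f" using bc1[OF t] by (simp add: N_def)
      also have "\<dots> \<le> M * (N t / 2 + f)"
        using nonneg pos by (simp add: M_def algebra_simps)
      finally show ?thesis using M by (simp add: field_simps)
    qed
    finally have "- 2 * p * w 1 t \<le> M * (1 + 2 * M) * E t + N t + f" by simp
    then show ?thesis
      by (simp add: E'_def L_def growth_rate_def p_def M_def algebra_simps)
  qed
  define h where "h t = exp (- L * t) * E t" for t
  define h' where "h' t = exp (- L * t) * (E' t - L * E t)" for t
  have "(h' has_integral h T - h 0) {0..T}"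
  proof (rule fundamental_theorem_of_calculus_interior)
    show "continuous_on {0..T} h"
      unfolding h_def by (intro continuous_intros E_cont)
    show "(h has_vector_derivative h' t) (at t)" if "t \<in> {0<..<T}" for t
      unfolding has_real_derivative_iff_has_vector_derivative[symmetric] h_def h'_def
      by (rule DERIV_cong, (rule derivative_intros E_deriv[OF that])+) (simp add: algebra_simps)
  qed (use T in simp)
  \<comment> \<open>The endpoints are dropped because \<open>E'\<close> is controlled only for \<open>0 < t < T\<close>.\<close>
  then have h'_int: "(h' has_integral h T) {0<..<T}"
    using E0 by (simp add: has_integral_Icc_iff_Ioo h_def)
  have bound_int: "((\<lambda>t. f - exp (- L * T) * N t) has_integral
      T * f - exp (- L * T) * integral {0..T} N) {0<..<T}"
  proof -
    have "(N has_integral integral {0..T} N) {0..T}"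
      using N_cont by (intro integrable_integral integrable_continuous_real) (simp add: N_def[abs_def])
    from has_integral_diff[OF has_integral_const_real[of f 0 T] has_integral_mult_right[OF this]]
    show ?thesis using T by (simp add: has_integral_Icc_iff_Ioo)
  qed
  have "h T \<le> T * f - exp (- L * T) * integral {0..T} N"
  proof (rule has_integral_le[OF h'_int bound_int])
    fix t assume t: "t \<in> {0<..<T}"
    have L: "L \<ge> 0" using nonneg by (simp add: L_def growth_rate_def)
    have "h' t \<le> exp (- L * t) * (f - N t)"
      unfolding h'_def using E'_le[OF t] by (intro mult_left_mono) auto
    also have "\<dots> = exp (- L * t) * f - exp (- L * t) * N t"
      by (simp add: algebra_simps)
    also have "\<dots> \<le> 1 * f - exp (- L * T) * N t"
      using nonneg L t N_nonneg[of t]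
      by (intro diff_mono mult_right_mono) (auto intro!: mult_left_mono)
    finally show "h' t \<le> f - exp (- L * T) * N t" by simp
  qed
  moreover have "h T \<ge> 0" using E_nonneg[of T] T by (simp add: h_def)
  ultimately have "exp (- L * T) * integral {0..T} N \<le> T * f" by simp
  then have "exp (L * T) * (exp (- L * T) * integral {0..T} N) \<le> exp (L * T) * (T * f)"
    by (intro mult_left_mono) auto
  then show "integral {0..T} (\<lambda>t. integral {0..1} (\<lambda>x. (w x t)\<^sup>2)) \<le> T * f * exp (growth_rate c K * T)"
    by (simp add: N_def[abs_def] L_def mult.assoc[symmetric] exp_add[symmetric] mult.commute)
qed

section \<open>Square-integrable functions and the parabolic class\<close>

lemma square_integrable_continuous:
  assumes "continuous_on {0..1} f"
  shows "square_integrable f"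
proof -
  have "continuous_on {0..1} (\<lambda>x. (f x)\<^sup>2)" using assms by (intro continuous_intros)
  then have "integrable (lebesgue_on {0..1}) (\<lambda>x. (f x)\<^sup>2)"
    using continuous_imp_integrable[of 0 1 "\<lambda>x. (f x)\<^sup>2"] by simp
  then show ?thesis
    unfolding square_integrable_def using assms
    by (simp add: continuous_imp_measurable_on_sets_lebesgue)
qed

lemma square_integrable_imp_integrable_on:
  "square_integrable f \<Longrightarrow> (\<lambda>x. (f x)\<^sup>2) integrable_on {0..1}"
  unfolding square_integrable_def by (intro integrable_on_lebesgue_on) auto

lemma square_diff_le: "(a - b)\<^sup>2 \<le> 2 * a\<^sup>2 + 2 * b\<^sup>2" for a b :: real
  using zero_le_power2[of "a + b"] by (simp add: power2_eq_square algebra_simps)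

lemma square_integrable_diff:
  assumes f: "square_integrable f" and g: "square_integrable g"
  shows "square_integrable (\<lambda>x. f x - g x)"
  unfolding square_integrable_def
proof
  show meas: "(\<lambda>x. f x - g x) \<in> borel_measurable (lebesgue_on {0..1})"
    using f g unfolding square_integrable_def by (intro borel_measurable_diff) auto
  show "integrable (lebesgue_on {0..1}) (\<lambda>x. (f x - g x)\<^sup>2)"
  proof (rule Bochner_Integration.integrable_bound)
    show "integrable (lebesgue_on {0..1}) (\<lambda>x. 2 * (f x)\<^sup>2 + 2 * (g x)\<^sup>2)"
      using f g by (simp add: square_integrable_def)
    show "(\<lambda>x. (f x - g x)\<^sup>2) \<in> borel_measurable (lebesgue_on {0..1})"
      using meas by simp
  qed (use square_diff_le in auto)
qed

lemma integral_square_diff_le: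
  assumes f: "square_integrable f" and g: "square_integrable g"
  shows "integral {0..1} (\<lambda>x. (f x - g x)\<^sup>2)
    \<le> 2 * integral {0..1} (\<lambda>x. (f x)\<^sup>2) + 2 * integral {0..1} (\<lambda>x. (g x)\<^sup>2)"
proof -
  note int = square_integrable_imp_integrable_on[OF f] square_integrable_imp_integrable_on[OF g]
  have "integral {0..1} (\<lambda>x. (f x - g x)\<^sup>2) \<le> integral {0..1} (\<lambda>x. 2 * (f x)\<^sup>2 + 2 * (g x)\<^sup>2)"
    by (intro integral_le square_integrable_imp_integrable_on square_integrable_diff f g
        integrable_add integrable_on_mult_right int square_diff_le)
  also have "\<dots> = 2 * integral {0..1} (\<lambda>x. (f x)\<^sup>2) + 2 * integral {0..1} (\<lambda>x. (g x)\<^sup>2)"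
    by (subst integral_add) (auto intro!: integrable_on_mult_right int)
  finally show ?thesis .
qed

lemma C21_parabolic_regular:
  assumes u: "C21 T I u" and I: "{0<..<T} \<subseteq> I"
  shows "parabolic_regular {0<..<T} u (partial_x u) (partial_x (partial_x u)) (partial_t T u)"
proof
  fix x t :: real assume x: "x \<in> {0..1}" and t: "t \<in> {0<..<T}"
  have tI: "t \<in> I" using t I by auto
  show "((\<lambda>\<xi>. u \<xi> t) has_real_derivative partial_x u x t) (at x within {0..1})"
    using u x tI unfolding C21_def C1_x_def
    by (simp add: partial_x_def has_real_derivative_iff_has_vector_derivative vector_derivative_works)
  show "((\<lambda>\<xi>. partial_x u \<xi> t) has_real_derivative partial_x (partial_x u) x t) (at x within {0..1})"
    using u x tI unfolding C21_def C1_x_def partial_x_def[of "partial_x u"]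
    by (simp add: has_real_derivative_iff_has_vector_derivative vector_derivative_works)
  have "((\<lambda>s. u x s) has_real_derivative partial_t T u x t) (at t within {0..T})"
    using u x tI unfolding C21_def
    by (simp add: partial_t_def has_real_derivative_iff_has_vector_derivative vector_derivative_works)
  then show "((\<lambda>s. u x s) has_real_derivative partial_t T u x t) (at t)"
    using t by (simp add: at_within_Icc_at)
next
  have sub: "{0..1} \<times> {0<..<T} \<subseteq> {0..1} \<times> I" using I by auto
  show "continuous_on ({0..1} \<times> {0<..<T}) (\<lambda>(x, t). u x t)"
    "continuous_on ({0..1} \<times> {0<..<T}) (\<lambda>(x, t). partial_x u x t)"
    "continuous_on ({0..1} \<times> {0<..<T}) (\<lambda>(x, t). partial_x (partial_x u) x t)"
    "continuous_on ({0..1} \<times> {0<..<T}) (\<lambda>(x, t). partial_t T u x t)"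
    using u continuous_on_subset[OF _ sub] unfolding C21_def C1_x_def by blast+
qed auto

section \<open>Kernels and states\<close>

lemma kern_diff: "kern (\<Theta>' - \<Theta>) x = kern \<Theta>' x - kern \<Theta> x"
  by (simp add: kern_def algebra_simps)

lemma continuous_on_kern: "continuous_on S (kern \<Theta>)"
  unfolding kern_def[abs_def] by (intro continuous_intros)

lemma integral_kern_square:
  "integral {0..1} (\<lambda>x. (kern \<Theta> x)\<^sup>2) = (\<Theta> $ 1)\<^sup>2 / 3 + \<Theta> $ 1 * \<Theta> $ 2 / 2 + (\<Theta> $ 2)\<^sup>2 / 5"
proof -
  have "((\<lambda>x. (\<Theta> $ 1)\<^sup>2 * x ^ 3 / 3 + \<Theta> $ 1 * \<Theta> $ 2 * x ^ 4 / 2 + (\<Theta> $ 2)\<^sup>2 * x ^ 5 / 5)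
      has_real_derivative (kern \<Theta> x)\<^sup>2) (at x within {0..1})" for x
    unfolding kern_def
    by (auto intro!: derivative_eq_intros simp: field_simps eval_nat_numeral)
  then show ?thesis by (subst integral_derivative) auto
qed

lemma norm_square_real2: "(norm (\<Theta> :: real ^ 2))\<^sup>2 = (\<Theta> $ 1)\<^sup>2 + (\<Theta> $ 2)\<^sup>2"
  by (simp add: norm_vec_def L2_set_def sum_2)

lemma integral_kern_square_le: "integral {0..1} (\<lambda>x. (kern \<Theta> x)\<^sup>2) \<le> (norm \<Theta>)\<^sup>2"
proof -
  have "2 * (\<Theta> $ 1 * \<Theta> $ 2) \<le> (\<Theta> $ 1)\<^sup>2 + (\<Theta> $ 2)\<^sup>2"
    using sum_squares_bound[of "\<Theta> $ 1" "\<Theta> $ 2"] by simp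
  then show ?thesis
    unfolding integral_kern_square norm_square_real2
    using zero_le_power2[of "\<Theta> $ 1"] zero_le_power2[of "\<Theta> $ 2"] by linarith
qed

text \<open>
  Near \<open>t = 0\<close> the state is \<open>L\<^sup>2\<close>-close to \<open>y0\<close>; away from \<open>0\<close> it is continuous on a compact
  rectangle.
\<close>

lemma state_square_integral_bounded:
  assumes y: "state_solution c T y0 \<Theta> y" and y0: "square_integrable y0"
  obtains B where "B \<ge> 0" "\<And>t. t \<in> {0<..<T} \<Longrightarrow> integral {0..1} (\<lambda>x. (y x t)\<^sup>2) \<le> B"
proof -
  define A where "A = 2 + 2 * integral {0..1} (\<lambda>x. (y0 x)\<^sup>2)"
  have cont: "continuous_on ({0..1} \<times> {0<..T}) (\<lambda>(x, t). y x t)"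
    using y unfolding state_solution_def C21_def C1_x_def by blast
  have lim: "((\<lambda>t. integral {0..1} (\<lambda>x. (y x t - y0 x)\<^sup>2)) \<longlongrightarrow> 0) (at_right 0)"
    using y unfolding state_solution_def by blast
  have sq: "square_integrable (\<lambda>x. y x t)" if "t \<in> {0<..T}" for t
    by (intro square_integrable_continuous continuous_on_slice[OF cont] that)
  have "\<forall>\<^sub>F t in at_right 0. integral {0..1} (\<lambda>x. (y x t - y0 x)\<^sup>2) < 1"
    using order_tendstoD(2)[OF lim, of 1] by simp
  then obtain s where s: "s > 0"
    "\<And>t. 0 < t \<Longrightarrow> t < s \<Longrightarrow> integral {0..1} (\<lambda>x. (y x t - y0 x)\<^sup>2) < 1"
    by (auto simp: eventually_at_right_field)
  have early: "integral {0..1} (\<lambda>x. (y x t)\<^sup>2) \<le> A" if t: "0 < t" "t < s" "t \<le> T" for t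
  proof -
    have "square_integrable (\<lambda>x. 0 - y0 x)"
      by (intro square_integrable_diff y0 square_integrable_continuous continuous_intros)
    from integral_square_diff_le[OF square_integrable_diff[OF sq y0] this, of t] s(2)[of t] t
    show ?thesis by (simp add: A_def)
  qed
  have "continuous_on ({0..1} \<times> {0<..T}) (\<lambda>(x, t). (y x t)\<^sup>2)"
    using continuous_on_power[OF cont, of 2] by (simp add: split_def)
  then have "continuous_on {0<..T} (\<lambda>t. integral {0..1} (\<lambda>x. (y x t)\<^sup>2))"
    by (rule continuous_on_space_integral)
  then have "continuous_on {s..T} (\<lambda>t. integral {0..1} (\<lambda>x. (y x t)\<^sup>2))"
    by (rule continuous_on_subset) (use s(1) in auto)
  then have "bounded ((\<lambda>t. integral {0..1} (\<lambda>x. (y x t)\<^sup>2)) ` {s..T})"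
    using compact_continuous_image compact_imp_bounded by blast
  then obtain C where "\<forall>z \<in> (\<lambda>t. integral {0..1} (\<lambda>x. (y x t)\<^sup>2)) ` {s..T}. \<bar>z\<bar> \<le> C"
    using bounded_real by blast
  then have C: "\<bar>integral {0..1} (\<lambda>x. (y x t)\<^sup>2)\<bar> \<le> C" if "t \<in> {s..T}" for t
    using that by blast
  show ?thesis
  proof
    show "integral {0..1} (\<lambda>x. (y x t)\<^sup>2) \<le> max 0 (max A C)" if "t \<in> {0<..<T}" for t
      using early[of t] C[of t] that by (cases "t < s") (auto simp: le_max_iff_disj)
  qed simp
qed

section \<open>Comparing two states\<close>

text \<open>
  The finite difference \<open>w = y' - y\<close> takes the place of a linearised state, so that no
  differentiability of the state in the parameter has to be shown.
\<close>

locale two_states =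
  fixes c T :: real and y0 :: "real \<Rightarrow> real"
    and \<Theta> \<Theta>' :: "real ^ 2" and y y' :: "real \<Rightarrow> real \<Rightarrow> real"
  assumes c: "c \<ge> 0" and T: "T > 0" and y0: "square_integrable y0"
    and state: "state_solution c T y0 \<Theta> y" and state': "state_solution c T y0 \<Theta>' y'"
begin

definition w where "w x t = y' x t - y x t"
definition wx where "wx x t = partial_x y' x t - partial_x y x t"
definition wxx where "wxx x t = partial_x (partial_x y') x t - partial_x (partial_x y) x t"
definition wt where "wt x t = partial_t T y' x t - partial_t T y x t"
definition N where "N t = integral {0..1} (\<lambda>x. (w x t)\<^sup>2)"

lemma y_cont: "continuous_on ({0..1} \<times> {0<..T}) (\<lambda>(x, t). y x t)"
  using state unfolding state_solution_def C21_def C1_x_def by blast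

lemma y'_cont: "continuous_on ({0..1} \<times> {0<..T}) (\<lambda>(x, t). y' x t)"
  using state' unfolding state_solution_def C21_def C1_x_def by blast

lemma w_cont: "continuous_on ({0..1} \<times> {0<..T}) (\<lambda>(x, t). w x t)"
  using continuous_on_diff[OF y'_cont y_cont] by (simp add: w_def split_def)

lemmas y_slice = continuous_on_slice[OF y_cont]
  and y'_slice = continuous_on_slice[OF y'_cont]
  and w_slice = continuous_on_slice[OF w_cont]

lemma w_regular: "parabolic_regular {0<..<T} w wx wxx wt"
  unfolding w_def[abs_def] wx_def[abs_def] wxx_def[abs_def] wt_def[abs_def]
  using state state' unfolding state_solution_def
  by (intro parabolic_regular_diff C21_parabolic_regular[where I = "{0<..T}"]) auto

lemma w_eq: "x \<in> {0..1} \<Longrightarrow> t \<in> {0<..<T} \<Longrightarrow> wt x t = wxx x t + c * w x t"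
  using state state' unfolding state_solution_def
  by (simp add: wt_def wxx_def w_def algebra_simps)

lemma w_at_0: "t \<in> {0<..T} \<Longrightarrow> w 0 t = 0"
  using state state' unfolding state_solution_def by (simp add: w_def)

lemma w_initial: "x \<in> {0..1} \<Longrightarrow> w x 0 = 0"
  using state state' unfolding state_solution_def by (simp add: w_def)

lemma N_0: "N 0 = 0"
  unfolding N_def using w_initial by (subst integral_cong[where g = "\<lambda>_. 0"]) auto

lemma N_nonneg: "t \<in> {0<..T} \<Longrightarrow> 0 \<le> N t"
  unfolding N_def
  by (intro integral_nonneg integrable_continuous_real continuous_intros w_slice) auto

lemma N_tendsto_0: "(N \<longlongrightarrow> 0) (at_right 0)"
proof (rule tendsto_sandwich)
  let ?d = "\<lambda>u t. integral {0..1} (\<lambda>x. (u x t - y0 x)\<^sup>2)"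
  have ev: "\<forall>\<^sub>F t in at_right 0. t \<in> {0<..<T}"
    using eventually_at_right_real[OF T] .
  show "\<forall>\<^sub>F t in at_right 0. 0 \<le> N t"
    using ev by eventually_elim (simp add: N_nonneg)
  show "\<forall>\<^sub>F t in at_right 0. N t \<le> 2 * ?d y' t + 2 * ?d y t"
    using ev
  proof eventually_elim
    case (elim t)
    then have "square_integrable (\<lambda>x. y' x t - y0 x)" "square_integrable (\<lambda>x. y x t - y0 x)"
      by (intro square_integrable_diff y0 square_integrable_continuous y_slice y'_slice; simp)+
    from integral_square_diff_le[OF this] show ?case
      by (simp add: N_def w_def)
  qed
  have "((\<lambda>t. ?d y' t) \<longlongrightarrow> 0) (at_right 0)" "((\<lambda>t. ?d y t) \<longlongrightarrow> 0) (at_right 0)"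
    using state state' unfolding state_solution_def by blast+
  then have "((\<lambda>t. 2 * ?d y' t + 2 * ?d y t) \<longlongrightarrow> 2 * 0 + 2 * 0) (at_right 0)"
    by (intro tendsto_intros)
  then show "((\<lambda>t. 2 * ?d y' t + 2 * ?d y t) \<longlongrightarrow> 0) (at_right 0)" by simp
qed simp

text \<open>
  Two ways to split \<open>k' y' - k y\<close>: the first, with the perturbation acting on the fixed state \<open>y\<close>,
  serves the stability estimate, where \<open>y'\<close> is not yet controlled; the second, with the kernel \<open>k\<close>
  of the costate acting on \<open>w\<close>, makes the duality computation exact.
\<close>

lemma w_at_1:
  assumes t: "t \<in> {0<..T}"
  shows "w 1 t = integral {0..1} (\<lambda>x. kern \<Theta>' x * w x t)
    + integral {0..1} (\<lambda>x. kern (\<Theta>' - \<Theta>) x * y x t)"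
    and "w 1 t = integral {0..1} (\<lambda>x. kern \<Theta> x * w x t)
    + integral {0..1} (\<lambda>x. kern (\<Theta>' - \<Theta>) x * y' x t)"
proof -
  note cs = continuous_on_kern w_slice[OF t] y_slice[OF t] y'_slice[OF t]
  have w1: "w 1 t = integral {0..1} (\<lambda>x. kern \<Theta>' x * y' x t)
      - integral {0..1} (\<lambda>x. kern \<Theta> x * y x t)"
    using state state' t unfolding state_solution_def by (simp add: w_def)
  also have "\<dots> = integral {0..1} (\<lambda>x. kern \<Theta>' x * y' x t - kern \<Theta> x * y x t)"
    by (intro integral_diff[symmetric] integrable_continuous_real continuous_intros cs)
  finally have w1: "w 1 t = integral {0..1} (\<lambda>x. kern \<Theta>' x * y' x t - kern \<Theta> x * y x t)" .
  have "integral {0..1} (\<lambda>x. kern \<Theta>' x * y' x t - kern \<Theta> x * y x t)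
      = integral {0..1} (\<lambda>x. kern \<Theta>' x * w x t + kern (\<Theta>' - \<Theta>) x * y x t)"
    by (intro integral_cong) (simp add: kern_diff w_def algebra_simps)
  also have "\<dots> = integral {0..1} (\<lambda>x. kern \<Theta>' x * w x t)
      + integral {0..1} (\<lambda>x. kern (\<Theta>' - \<Theta>) x * y x t)"
    by (intro integral_add integrable_continuous_real continuous_intros cs)
  finally show "w 1 t = \<dots>" using w1 by simp
  have "integral {0..1} (\<lambda>x. kern \<Theta>' x * y' x t - kern \<Theta> x * y x t)
      = integral {0..1} (\<lambda>x. kern \<Theta> x * w x t + kern (\<Theta>' - \<Theta>) x * y' x t)"
    by (intro integral_cong) (simp add: kern_diff w_def algebra_simps)
  also have "\<dots> = integral {0..1} (\<lambda>x. kern \<Theta> x * w x t)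
      + integral {0..1} (\<lambda>x. kern (\<Theta>' - \<Theta>) x * y' x t)"
    by (intro integral_add integrable_continuous_real continuous_intros cs)
  finally show "w 1 t = \<dots>" using w1 by simp
qed

text \<open>
  By Cauchy--Schwarz the boundary value \<open>w(1)\<close> consists of a multiple of the \<open>L\<^sup>2\<close> norm of \<open>w\<close> and a
  forcing proportional to \<open>\<bar>\<Theta>' - \<Theta>\<bar>\<close>. The factor of \<open>\<bar>\<Theta>' - \<Theta>\<bar>\<^sup>2\<close> depends on \<open>\<Theta>'\<close> only through \<open>R\<close>, so it
  is uniform near \<open>\<Theta>\<close>.
\<close>

lemma state_Lipschitz:
  assumes B: "\<And>t. t \<in> {0<..<T} \<Longrightarrow> integral {0..1} (\<lambda>x. (y x t)\<^sup>2) \<le> B" "B \<ge> 0"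
    and R: "norm \<Theta>' \<le> R"
  shows "continuous_on {0..T} N"
    and "integral {0..T} N
      \<le> T * (2 * B * (norm (\<Theta>' - \<Theta>))\<^sup>2) * exp (growth_rate c (2 * R\<^sup>2) * T)"
proof -
  have bc1: "(w 1 t)\<^sup>2 \<le> 2 * R\<^sup>2 * integral {0..1} (\<lambda>x. (w x t)\<^sup>2) + 2 * B * (norm (\<Theta>' - \<Theta>))\<^sup>2"
    if t: "t \<in> {0<..<T}" for t
  proof -
    have tT: "t \<in> {0<..T}" using t by simp
    define a where "a = integral {0..1} (\<lambda>x. kern \<Theta>' x * w x t)"
    define b where "b = integral {0..1} (\<lambda>x. kern (\<Theta>' - \<Theta>) x * y x t)"
    have "a\<^sup>2 \<le> integral {0..1} (\<lambda>x. (kern \<Theta>' x)\<^sup>2) * N t"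
      unfolding a_def N_def by (intro Cauchy_Schwarz_integral continuous_on_kern w_slice tT)
    also have "\<dots> \<le> R\<^sup>2 * N t"
      using N_nonneg[OF tT] integral_kern_square_le[of \<Theta>'] power_mono[OF R, of 2]
      by (intro mult_right_mono) auto
    finally have a: "a\<^sup>2 \<le> R\<^sup>2 * N t" .
    have "b\<^sup>2 \<le> integral {0..1} (\<lambda>x. (kern (\<Theta>' - \<Theta>) x)\<^sup>2) * integral {0..1} (\<lambda>x. (y x t)\<^sup>2)"
      unfolding b_def by (intro Cauchy_Schwarz_integral continuous_on_kern y_slice tT)
    also have "\<dots> \<le> (norm (\<Theta>' - \<Theta>))\<^sup>2 * B"
      by (intro mult_mono integral_kern_square_le B t integral_nonneg integrable_continuous_real
          continuous_intros y_slice tT) auto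
    finally have b: "b\<^sup>2 \<le> (norm (\<Theta>' - \<Theta>))\<^sup>2 * B" .
    have "(w 1 t)\<^sup>2 = (a - - b)\<^sup>2"
      using w_at_1(1)[OF tT] by (simp add: a_def b_def)
    also have "\<dots> \<le> 2 * a\<^sup>2 + 2 * b\<^sup>2"
      using square_diff_le[of a "- b"] by simp
    finally show ?thesis using a b by (simp add: N_def algebra_simps)
  qed
  show "continuous_on {0..T} N"
    and "integral {0..T} N
      \<le> T * (2 * B * (norm (\<Theta>' - \<Theta>))\<^sup>2) * exp (growth_rate c (2 * R\<^sup>2) * T)"
    using nonlocal_heat_stability[OF w_regular T w_cont w_eq w_at_0 bc1 w_initial _ c]
      N_tendsto_0 \<open>B \<ge> 0\<close>
    by (simp_all add: N_def[abs_def])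
qed

text \<open>
  The function \<open>\<integral> v w\<close> vanishes at \<open>t = 0\<close>, as \<open>w\<close> does, and at \<open>t = T\<close>, as \<open>v\<close> does; hence its
  derivative has integral zero. Continuity at \<open>0\<close> comes from the \<open>L\<^sup>2\<close> convergence of \<open>w\<close>, and the
  fundamental theorem itself provides the integrability of the derivative up to both ends.
\<close>

lemma adjoint_identity:
  assumes v: "costate_solution c T y \<Theta> v"
  shows "((\<lambda>t. partial_x v 1 t * integral {0..1} (\<lambda>x. kern (\<Theta>' - \<Theta>) x * y' x t)
      + integral {0..1} (\<lambda>x. y x t * w x t)) has_integral 0) {0<..<T}"
proof -
  define H where "H t = integral {0..1} (\<lambda>x. v x t * w x t)" for t
  have v_cont: "continuous_on ({0..1} \<times> {0..T}) (\<lambda>(x, t). v x t)"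
    using v unfolding costate_solution_def C1_x_def by blast
  have v_reg: "parabolic_regular {0<..<T} v (partial_x v) (partial_x (partial_x v)) (partial_t T v)"
    using v unfolding costate_solution_def by (intro C21_parabolic_regular) auto
  have H_deriv: "(H has_real_derivative
      - (partial_x v 1 t * integral {0..1} (\<lambda>x. kern (\<Theta>' - \<Theta>) x * y' x t)
        + integral {0..1} (\<lambda>x. y x t * w x t))) (at t)" if t: "t \<in> {0<..<T}" for t
  proof -
    have tT: "t \<in> {0<..T}" using t by simp
    have "(H has_real_derivative
        - partial_x v 1 t * (w 1 t - integral {0..1} (\<lambda>x. kern \<Theta> x * w x t))
          - integral {0..1} (\<lambda>x. y x t * w x t)) (at t)"
      unfolding H_def
      by (rule DERIV_duality_pairing[OF w_regular v_reg t w_eq])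
        (use v t tT w_at_0 in \<open>auto simp: costate_solution_def intro: y_slice continuous_on_kern\<close>)
    then show ?thesis using w_at_1(2)[OF tT] by simp
  qed
  have H0: "H 0 = 0"
    unfolding H_def using w_initial by (subst integral_cong[where g = "\<lambda>_. 0"]) auto
  have HT: "H T = 0"
    unfolding H_def using v T
    by (subst integral_cong[where g = "\<lambda>_. 0"]) (auto simp: costate_solution_def)
  have H_cont: "continuous_on {0..T} H"
  proof (rule continuous_on_Icc_from_Ioc)
    have "continuous_on ({0..1} \<times> {0<..T}) (\<lambda>(x, t). v x t)"
      by (rule continuous_on_subset[OF v_cont]) auto
    from continuous_on_mult[OF this w_cont]
    show "continuous_on {0<..T} H"
      unfolding H_def by (intro continuous_on_space_integral) (simp add: split_def)
    define V where "V t = integral {0..1} (\<lambda>x. (v x t)\<^sup>2)" for t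
    have "continuous_on ({0..1} \<times> {0..T}) (\<lambda>(x, t). (v x t)\<^sup>2)"
      using continuous_on_power[OF v_cont, of 2] by (simp add: split_def)
    then have "continuous_on {0..T} V"
      unfolding V_def by (rule continuous_on_space_integral)
    then have "(V \<longlongrightarrow> V 0) (at_right 0)"
      using T by (auto simp: continuous_on at_within_Icc_at_right dest: bspec[of _ _ 0])
    then have "((\<lambda>t. sqrt (V t * N t)) \<longlongrightarrow> sqrt (V 0 * 0)) (at_right 0)"
      by (intro tendsto_intros N_tendsto_0)
    then have lim: "((\<lambda>t. sqrt (V t * N t)) \<longlongrightarrow> 0) (at_right 0)" by simp
    have "(H \<longlongrightarrow> 0) (at_right 0)"
    proof (rule Lim_null_comparison[OF _ lim])
      show "\<forall>\<^sub>F t in at_right 0. norm (H t) \<le> sqrt (V t * N t)"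
        using eventually_at_right_real[OF T]
      proof eventually_elim
        case (elim t)
        then have t: "t \<in> {0<..T}" "t \<in> {0..T}" by auto
        have "(H t)\<^sup>2 \<le> V t * N t"
          unfolding H_def V_def N_def
          by (intro Cauchy_Schwarz_integral continuous_on_slice[OF v_cont] w_slice t)
        then show ?case by (simp add: real_le_rsqrt)
      qed
    qed
    then show "(H \<longlongrightarrow> H 0) (at_right 0)" using H0 by simp
  qed (use T in simp)
  have "((\<lambda>t. - (partial_x v 1 t * integral {0..1} (\<lambda>x. kern (\<Theta>' - \<Theta>) x * y' x t)
      + integral {0..1} (\<lambda>x. y x t * w x t))) has_integral H T - H 0) {0..T}"
    by (rule fundamental_theorem_of_calculus_interior[OF _ H_cont])
      (use T H_deriv in \<open>auto simp: has_real_derivative_iff_has_vector_derivative\<close>)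
  from has_integral_neg[OF this] show ?thesis
    using H0 HT by (simp add: has_integral_Icc_iff_Ioo add.commute)
qed

end

context two_states
begin

text \<open>
  From \<open>y'\<^sup>2 = y\<^sup>2 + 2 y w + w\<^sup>2\<close> and the adjoint identity, the tracking term changes by
  \<open>- \<integral> v\<^sub>x(1) \<integral> (k' - k) y'\<close> plus half of the space-time integral of \<open>w\<^sup>2\<close>. Replacing \<open>y'\<close> by \<open>y\<close>
  turns the first part into the linear term and leaves an error bounded by the geometric mean of
  two quantities of second order.
\<close>

lemma cost_expansion:
  assumes v: "costate_solution c T y \<Theta> v"
    and B: "\<And>t. t \<in> {0<..<T} \<Longrightarrow> integral {0..1} (\<lambda>x. (y x t)\<^sup>2) \<le> B" "B \<ge> 0"
    and M: "\<And>t. t \<in> {0..T} \<Longrightarrow> \<bar>partial_x v 1 t\<bar> \<le> M"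
    and N_cont: "continuous_on {0..T} N"
  defines "Q \<equiv> \<lambda>g. integral {0..T} (\<lambda>t. integral {0..1} (\<lambda>x. g x * partial_x v 1 t * y x t))"
    and "J \<equiv> \<lambda>u. integral {0..T} (\<lambda>t. integral {0..1} (\<lambda>x. (u x t)\<^sup>2))"
  shows "\<bar>1 / 2 * J y' - 1 / 2 * J y
      + ((\<Theta>' - \<Theta>) $ 1 * Q (\<lambda>x. x) + (\<Theta>' - \<Theta>) $ 2 * Q (\<lambda>x. x\<^sup>2))\<bar>
    \<le> M / 2 * (T * (norm (\<Theta>' - \<Theta>))\<^sup>2 + integral {0..T} N) + 1 / 2 * integral {0..T} N"
proof -
  \<comment> \<open>\<open>r\<close> is the error made by replacing \<open>y'\<close> by \<open>y\<close>; \<open>q g\<close> is the integrand of the linear term.\<close>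
  define \<delta> where "\<delta> = \<Theta>' - \<Theta>"
  define r where "r t = partial_x v 1 t * integral {0..1} (\<lambda>x. kern \<delta> x * w x t)" for t
  define q where "q g t = partial_x v 1 t * integral {0..1} (\<lambda>x. g x * y x t)"
    for g :: "real \<Rightarrow> real" and t
  define yy where "yy t = integral {0..1} (\<lambda>x. (y x t)\<^sup>2)" for t
  define yw where "yw t = integral {0..1} (\<lambda>x. y x t * w x t)" for t
  have M0: "M \<ge> 0" using M[of 0] T by simp
  have y_cont': "continuous_on ({0..1} \<times> {0<..<T}) (\<lambda>(x, t). y x t)"
    and w_cont': "continuous_on ({0..1} \<times> {0<..<T}) (\<lambda>(x, t). w x t)"
    by (rule continuous_on_subset[OF y_cont] continuous_on_subset[OF w_cont]; auto)+
  have flux_cont: "continuous_on {0<..<T} (\<lambda>t. partial_x v 1 t)"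
  proof -
    have "continuous_on ({0..1} \<times> {0..T}) (\<lambda>(x, t). partial_x v x t)"
      using v unfolding costate_solution_def C1_x_def by blast
    then have "continuous_on {0<..<T} (\<lambda>t. case (1, t) of (x, t) \<Rightarrow> partial_x v x t)"
      by (rule continuous_on_compose2) (auto intro!: continuous_intros)
    then show ?thesis by simp
  qed
  have pairing_cont: "continuous_on {0<..<T} (\<lambda>t. integral {0..1} (\<lambda>x. g x * u x t))"
    if u: "continuous_on ({0..1} \<times> {0<..<T}) (\<lambda>(x, t). u x t)" and g: "continuous_on {0..1} g"
    for u :: "real \<Rightarrow> real \<Rightarrow> real" and g
  proof (rule continuous_on_space_integral)
    have "continuous_on ({0..1} \<times> {0<..<T}) (\<lambda>p. g (fst p))"
      by (rule continuous_on_compose2[OF g]) (auto intro!: continuous_intros)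
    from continuous_on_mult[OF this u]
    show "continuous_on ({0..1} \<times> {0<..<T}) (\<lambda>(x, t). g x * u x t)"
      by (simp add: split_def)
  qed
  have kern_w: "\<bar>r t\<bar> \<le> M / 2 * ((norm \<delta>)\<^sup>2 + N t)" if t: "t \<in> {0<..<T}" for t
  proof -
    have tT: "t \<in> {0<..T}" using t by simp
    define i where "i = integral {0..1} (\<lambda>x. kern \<delta> x * w x t)"
    have "i\<^sup>2 \<le> integral {0..1} (\<lambda>x. (kern \<delta> x)\<^sup>2) * N t"
      unfolding i_def N_def by (intro Cauchy_Schwarz_integral continuous_on_kern w_slice tT)
    also have "\<dots> \<le> (norm \<delta>)\<^sup>2 * N t"
      by (intro mult_right_mono integral_kern_square_le N_nonneg tT)
    finally have "\<bar>i\<bar> \<le> sqrt ((norm \<delta>)\<^sup>2 * N t)"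
      using real_sqrt_le_mono by fastforce
    also have "\<dots> \<le> ((norm \<delta>)\<^sup>2 + N t) / 2"
      by (intro arith_geo_mean_sqrt N_nonneg tT) simp
    finally have "\<bar>partial_x v 1 t\<bar> * \<bar>i\<bar> \<le> M * (((norm \<delta>)\<^sup>2 + N t) / 2)"
      using M[of t] t M0 by (intro mult_mono) auto
    then show ?thesis by (simp add: r_def i_def abs_mult)
  qed
  have N_int: "N integrable_on {0<..<T}"
    using integrable_continuous_real[OF N_cont] by (simp add: integrable_on_Icc_iff_Ioo)
  have r_int: "r integrable_on {0<..<T}"
  proof -
    have "bounded (N ` {0..T})"
      using N_cont compact_continuous_image compact_imp_bounded by blast
    then obtain S where "\<forall>z \<in> N ` {0..T}. \<bar>z\<bar> \<le> S" using bounded_real by blast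
    then have S: "N t \<le> S" if "t \<in> {0..T}" for t using that by force
    have "r integrable_on {0..T}"
    proof (rule integrable_bounded_continuous)
      show "continuous_on {0<..<T} r"
        unfolding r_def
        by (intro continuous_on_mult flux_cont pairing_cont w_cont' continuous_on_kern)
      show "\<bar>r t\<bar> \<le> M / 2 * ((norm \<delta>)\<^sup>2 + S)" if "t \<in> {0<..<T}" for t
        using kern_w[OF that] S[of t] that M0
        by (meson add_left_mono atLeastAtMost_iff greaterThanLessThan_iff less_imp_le
            mult_left_mono order_trans divide_nonneg_pos zero_less_numeral)
    qed
    then show ?thesis by (simp add: integrable_on_Icc_iff_Ioo)
  qed
  have yy_int: "yy integrable_on {0<..<T}"
  proof -
    have "yy integrable_on {0..T}"
    proof (rule integrable_bounded_continuous)
      have "continuous_on ({0..1} \<times> {0<..<T}) (\<lambda>(x, t). (y x t)\<^sup>2)"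
        using continuous_on_power[OF y_cont', of 2] by (simp add: split_def)
      then show "continuous_on {0<..<T} yy"
        unfolding yy_def by (rule continuous_on_space_integral)
      show "\<bar>yy t\<bar> \<le> B" if t: "t \<in> {0<..<T}" for t
      proof -
        have "yy t \<ge> 0" unfolding yy_def using t
          by (intro integral_nonneg integrable_continuous_real continuous_intros y_slice) auto
        then show ?thesis using B(1)[OF t] by (simp add: yy_def)
      qed
    qed
    then show ?thesis by (simp add: integrable_on_Icc_iff_Ioo)
  qed
  have q_int: "(q g has_integral Q g) {0<..<T}" if g: "continuous_on {0..1} g" for g
  proof -
    define G where "G = integral {0..1} (\<lambda>x. (g x)\<^sup>2)"
    have G0: "G \<ge> 0" unfolding G_def
      by (intro integral_nonneg integrable_continuous_real continuous_intros g) auto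
    have "q g integrable_on {0..T}"
    proof (rule integrable_bounded_continuous)
      show "continuous_on {0<..<T} (q g)"
        unfolding q_def by (intro continuous_on_mult flux_cont pairing_cont y_cont' g)
      show "\<bar>q g t\<bar> \<le> M * sqrt (G * B)" if t: "t \<in> {0<..<T}" for t
      proof -
        have tT: "t \<in> {0<..T}" using t by simp
        define i where "i = integral {0..1} (\<lambda>x. g x * y x t)"
        have "i\<^sup>2 \<le> G * yy t"
          unfolding i_def G_def yy_def by (intro Cauchy_Schwarz_integral g y_slice tT)
        also have "\<dots> \<le> G * B"
          using B(1)[OF t] G0 by (intro mult_left_mono) (auto simp: yy_def)
        finally have "\<bar>i\<bar> \<le> sqrt (G * B)"
          using real_sqrt_le_mono by fastforce
        then have "\<bar>partial_x v 1 t\<bar> * \<bar>i\<bar> \<le> M * sqrt (G * B)"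
          using M[of t] t M0 by (intro mult_mono) auto
        then show ?thesis by (simp add: q_def i_def abs_mult)
      qed
    qed
    then have "(q g has_integral integral {0..T} (q g)) {0..T}"
      by (rule integrable_integral)
    moreover have "q g t = integral {0..1} (\<lambda>x. g x * partial_x v 1 t * y x t)" for t
      unfolding q_def by (subst integral_mult_right[symmetric]) (simp add: mult_ac)
    then have "integral {0..T} (q g) = Q g"
      by (simp add: Q_def cong: integral_cong)
    ultimately show ?thesis by (simp add: has_integral_Icc_iff_Ioo)
  qed
  define P where "P = \<delta> $ 1 * Q (\<lambda>x. x) + \<delta> $ 2 * Q (\<lambda>x. x\<^sup>2)"
  have P_int: "((\<lambda>t. \<delta> $ 1 * q (\<lambda>x. x) t + \<delta> $ 2 * q (\<lambda>x. x\<^sup>2) t) has_integral P) {0<..<T}"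
    unfolding P_def
    by (intro has_integral_add has_integral_mult_right q_int continuous_intros)
  define R where "R = integral {0<..<T} r"
  have yw_int: "(yw has_integral - (P + R)) {0<..<T}"
  proof -
    have "((\<lambda>t. (partial_x v 1 t * integral {0..1} (\<lambda>x. kern \<delta> x * y' x t) + yw t)
        - ((\<delta> $ 1 * q (\<lambda>x. x) t + \<delta> $ 2 * q (\<lambda>x. x\<^sup>2) t) + r t)) has_integral 0 - (P + R)) {0<..<T}"
      unfolding R_def yw_def \<delta>_def[symmetric]
      by (intro has_integral_diff has_integral_add P_int integrable_integral r_int
          adjoint_identity[OF v, folded \<delta>_def])
    moreover have "partial_x v 1 t * integral {0..1} (\<lambda>x. kern \<delta> x * y' x t)
        = (\<delta> $ 1 * q (\<lambda>x. x) t + \<delta> $ 2 * q (\<lambda>x. x\<^sup>2) t) + r t" if t: "t \<in> {0<..<T}" for t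
    proof -
      have tT: "t \<in> {0<..T}" using t by simp
      have "integral {0..1} (\<lambda>x. kern \<delta> x * y' x t)
          = integral {0..1} (\<lambda>x. \<delta> $ 1 * (x * y x t) + \<delta> $ 2 * (x\<^sup>2 * y x t) + kern \<delta> x * w x t)"
        by (intro integral_cong) (simp add: kern_def w_def algebra_simps)
      also have "\<dots> = \<delta> $ 1 * integral {0..1} (\<lambda>x. x * y x t)
          + \<delta> $ 2 * integral {0..1} (\<lambda>x. x\<^sup>2 * y x t) + integral {0..1} (\<lambda>x. kern \<delta> x * w x t)"
        by (subst integral_add, (intro integrable_continuous_real continuous_intros
            continuous_on_kern y_slice w_slice tT)+)+ simp
      finally show ?thesis by (simp add: q_def r_def algebra_simps)
    qed
    ultimately have "((\<lambda>t. yw t) has_integral 0 - (P + R)) {0<..<T}"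
      by (subst (asm) has_integral_cong[where g = yw]) auto
    then show ?thesis by simp
  qed
  have N_has: "(N has_integral integral {0..T} N) {0<..<T}"
    using N_int by (simp add: integral_open_interval_real integrable_integral)
  have yy_has: "(yy has_integral J y) {0<..<T}"
    using yy_int unfolding J_def yy_def[symmetric]
    by (simp add: integral_open_interval_real integrable_integral)
  have "((\<lambda>t. yy t + 2 * yw t + N t) has_integral J y + 2 * - (P + R) + integral {0..T} N) {0<..<T}"
    by (intro has_integral_add has_integral_mult_right yy_has yw_int N_has)
  moreover have "yy t + 2 * yw t + N t = integral {0..1} (\<lambda>x. (y' x t)\<^sup>2)" if t: "t \<in> {0<..<T}" for t
  proof -
    have tT: "t \<in> {0<..T}" using t by simp
    have "integral {0..1} (\<lambda>x. (y' x t)\<^sup>2)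
        = integral {0..1} (\<lambda>x. (y x t)\<^sup>2 + 2 * (y x t * w x t) + (w x t)\<^sup>2)"
      by (intro integral_cong) (simp add: w_def power2_eq_square algebra_simps)
    also have "\<dots> = yy t + 2 * yw t + N t"
      unfolding yy_def yw_def N_def
      by (subst integral_add, (intro integrable_continuous_real continuous_intros
          y_slice w_slice tT)+)+ simp
    finally show ?thesis by simp
  qed
  ultimately have "((\<lambda>t. integral {0..1} (\<lambda>x. (y' x t)\<^sup>2)) has_integral
      J y + 2 * - (P + R) + integral {0..T} N) {0<..<T}"
    by (subst (asm) has_integral_cong) auto
  then have "J y' = J y + 2 * - (P + R) + integral {0..T} N"
    unfolding J_def by (simp add: has_integral_Icc_iff_Ioo[symmetric] integral_unique)
  then have "1 / 2 * J y' - 1 / 2 * J y + P = 1 / 2 * integral {0..T} N - R"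
    by (simp add: field_simps)
  moreover have "\<bar>R\<bar> \<le> M / 2 * (T * (norm \<delta>)\<^sup>2 + integral {0..T} N)"
  proof -
    have bound: "((\<lambda>t. M / 2 * ((norm \<delta>)\<^sup>2 + N t)) has_integral
        M / 2 * (T * (norm \<delta>)\<^sup>2 + integral {0..T} N)) {0<..<T}"
      using has_integral_const_real[of "(norm \<delta>)\<^sup>2" 0 T] T
      by (intro has_integral_mult_right has_integral_add N_has) (simp add: has_integral_Icc_iff_Ioo)
    have "norm (integral {0<..<T} r) \<le> integral {0<..<T} (\<lambda>t. M / 2 * ((norm \<delta>)\<^sup>2 + N t))"
      by (rule integral_norm_bound_integral[OF r_int has_integral_integrable[OF bound]])
        (use kern_w in simp)
    then show ?thesis
      unfolding integral_unique[OF bound] by (simp add: R_def)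
  qed
  moreover have "integral {0..T} N \<ge> 0"
    using N_cont N_nonneg N_0
    by (intro integral_nonneg integrable_continuous_real) (auto simp: le_less)
  ultimately have "\<bar>1 / 2 * J y' - 1 / 2 * J y + P\<bar>
      \<le> M / 2 * (T * (norm \<delta>)\<^sup>2 + integral {0..T} N) + 1 / 2 * integral {0..T} N"
    by linarith
  then show ?thesis by (simp only: P_def \<delta>_def)
qed

end

lemma GDERIV_quadratic_remainder:
  fixes f :: "'a::real_inner \<Rightarrow> real"
  assumes "\<And>x'. norm (x' - x) \<le> 1 \<Longrightarrow> \<bar>f x' - f x - (x' - x) \<bullet> g\<bar> \<le> C * (norm (x' - x))\<^sup>2"
  shows "GDERIV f x :> g"
  unfolding gderiv_def has_derivative_at
proof
  show "bounded_linear (\<lambda>h. h \<bullet> g)" by (rule bounded_linear_inner_left)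
  show "((\<lambda>h. norm (f (x + h) - f x - h \<bullet> g) / norm h) \<longlongrightarrow> 0) (at 0)"
  proof (rule Lim_null_comparison)
    have "\<forall>\<^sub>F h in at 0. norm (h::'a) < 1"
      by (auto simp: eventually_at intro!: exI[of _ 1])
    then show "\<forall>\<^sub>F h in at 0. norm (norm (f (x + h) - f x - h \<bullet> g) / norm h) \<le> C * norm h"
    proof eventually_elim
      case (elim h)
      then show ?case
        using assms[of "x + h"]
        by (cases "h = 0") (auto simp: field_simps power2_eq_square)
    qed
    show "((\<lambda>h::'a. C * norm h) \<longlongrightarrow> 0) (at 0)"
      by (rule tendsto_eq_intros refl | simp)+
  qed
qed

lemma inner_vector2: "(x :: real ^ 2) \<bullet> vector [a, b] = x $ 1 * a + x $ 2 * b"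
  by (simp add: inner_vec_def sum_2)

lemma GDERIV_real2_partials:
  fixes f :: "real ^ 2 \<Rightarrow> real"
  assumes "GDERIV f x :> vector [a, b]"
  shows "((\<lambda>s. f (vector [s, x $ 2])) has_real_derivative a) (at (x $ 1))"
    and "((\<lambda>s. f (vector [x $ 1, s])) has_real_derivative b) (at (x $ 2))"
proof -
  have x: "vector [x $ 1, x $ 2] = x" by (simp add: vec_eq_iff forall_2)
  have f: "(f has_derivative (\<lambda>h. h \<bullet> vector [a, b])) (at (vector [x $ 1, x $ 2]))"
    using assms by (simp add: gderiv_def x)
  have vec: "vector [s, t] = s *\<^sub>R axis 1 1 + t *\<^sub>R (axis 2 1 :: real ^ 2)" for s t :: real
    by (simp add: vec_eq_iff forall_2 axis_def)
  have "((\<lambda>s. vector [s, x $ 2] :: real ^ 2) has_derivative (\<lambda>h. h *\<^sub>R axis 1 1)) (at (x $ 1))"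
    unfolding vec by (auto intro!: derivative_eq_intros)
  from has_derivative_compose[OF this f]
  show "((\<lambda>s. f (vector [s, x $ 2])) has_real_derivative a) (at (x $ 1))"
    unfolding has_field_derivative_def
    by (rule has_derivative_eq_rhs) (simp add: fun_eq_iff inner_vector2 axis_def)
  have "((\<lambda>s. vector [x $ 1, s] :: real ^ 2) has_derivative (\<lambda>h. h *\<^sub>R axis 2 1)) (at (x $ 2))"
    unfolding vec by (auto intro!: derivative_eq_intros)
  from has_derivative_compose[OF this f]
  show "((\<lambda>s. f (vector [x $ 1, s])) has_real_derivative b) (at (x $ 2))"
    unfolding has_field_derivative_def
    by (rule has_derivative_eq_rhs) (simp add: fun_eq_iff inner_vector2 axis_def)
qed

section \<open>The gradient of the cost\<close>

theorem theorem3p1: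
  fixes c T :: real
    and y0 :: "real \<Rightarrow> real"
    and y v :: "real ^ 2 \<Rightarrow> real \<Rightarrow> real \<Rightarrow> real"
    and \<Theta> :: "real ^ 2"
    and D1 D2 :: real
  assumes "c > 0" and "T > 0"
    and "square_integrable y0"
    and "\<And>\<Theta>'. state_solution c T y0 \<Theta>' (y \<Theta>')"
    and "\<And>\<Theta>'. costate_solution c T (y \<Theta>') \<Theta>' (v \<Theta>')"
  defines "D1 \<equiv>
      - integral {0..T} (\<lambda>t. integral {0..1} (\<lambda>x. x * partial_x (v \<Theta>) 1 t * y \<Theta> x t))
        + 1 / 3 * \<Theta> $ 1 + 1 / 4 * \<Theta> $ 2"
    and "D2 \<equiv>
      - integral {0..T} (\<lambda>t. integral {0..1} (\<lambda>x. x\<^sup>2 * partial_x (v \<Theta>) 1 t * y \<Theta> x t))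
        + 1 / 4 * \<Theta> $ 1 + 1 / 5 * \<Theta> $ 2"
  shows "(GDERIV (cost T y) \<Theta> :> vector [D1, D2]) \<and>
     ((\<lambda>s. cost T y (vector [s, \<Theta> $ 2])) has_real_derivative D1) (at (\<Theta> $ 1)) \<and>
     ((\<lambda>s. cost T y (vector [\<Theta> $ 1, s])) has_real_derivative D2) (at (\<Theta> $ 2))"
proof -
  note state = assms(4) and costate = assms(5)
  obtain B where B: "B \<ge> 0"
    "\<And>t. t \<in> {0<..<T} \<Longrightarrow> integral {0..1} (\<lambda>x. (y \<Theta> x t)\<^sup>2) \<le> B"
    using state_square_integral_bounded[OF state \<open>square_integrable y0\<close>] by metis
  obtain M where M: "\<And>t. t \<in> {0..T} \<Longrightarrow> \<bar>partial_x (v \<Theta>) 1 t\<bar> \<le> M"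
  proof -
    have "continuous_on ({0..1} \<times> {0..T}) (\<lambda>(x, t). partial_x (v \<Theta>) x t)"
      using costate[of \<Theta>] unfolding costate_solution_def C1_x_def by blast
    then have "bounded ((\<lambda>(x, t). partial_x (v \<Theta>) x t) ` ({0..1} \<times> {0..T}))"
      by (intro compact_imp_bounded compact_continuous_image compact_Times) auto
    then obtain M where "\<forall>z \<in> (\<lambda>(x, t). partial_x (v \<Theta>) x t) ` ({0..1} \<times> {0..T}). \<bar>z\<bar> \<le> M"
      using bounded_real by blast
    then show thesis using that by fastforce
  qed
  \<comment> \<open>The stability constant must not depend on \<open>\<Theta>'\<close>, so its norm is bounded on the unit ball around \<open>\<Theta>\<close>.\<close>
  define R where "R = norm \<Theta> + 1"
  define A where "A = T * (2 * B) * exp (growth_rate c (2 * R\<^sup>2) * T)"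
  define C where "C = M / 2 * (T + A) + 1 / 2 * A + 1 / 2"
  have "\<bar>cost T y \<Theta>' - cost T y \<Theta> - (\<Theta>' - \<Theta>) \<bullet> vector [D1, D2]\<bar> \<le> C * (norm (\<Theta>' - \<Theta>))\<^sup>2"
    if near: "norm (\<Theta>' - \<Theta>) \<le> 1" for \<Theta>'
  proof -
    interpret two_states c T y0 \<Theta> \<Theta>' "y \<Theta>" "y \<Theta>'"
      using assms by unfold_locales auto
    define d where "d = (norm (\<Theta>' - \<Theta>))\<^sup>2"
    have R: "norm \<Theta>' \<le> R"
      using norm_triangle_ineq[of "\<Theta>' - \<Theta>" \<Theta>] near by (simp add: R_def)
    have M0: "M \<ge> 0" using M[of 0] \<open>T > 0\<close> by simp
    have N_le: "integral {0..T} N \<le> A * d"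
      using state_Lipschitz(2)[OF B(2,1) R] by (simp add: A_def d_def mult_ac)
    define J where "J u = 1 / 2 * integral {0..T} (\<lambda>t. integral {0..1} (\<lambda>x. (u x t)\<^sup>2))"
      for u :: "real \<Rightarrow> real \<Rightarrow> real"
    define Q where "Q g = integral {0..T} (\<lambda>t. integral {0..1} (\<lambda>x. g x * partial_x (v \<Theta>) 1 t * y \<Theta> x t))"
      for g :: "real \<Rightarrow> real"
    have "\<bar>J (y \<Theta>') - J (y \<Theta>) + ((\<Theta>' - \<Theta>) $ 1 * Q (\<lambda>x. x) + (\<Theta>' - \<Theta>) $ 2 * Q (\<lambda>x. x\<^sup>2))\<bar>
        \<le> M / 2 * (T * d + integral {0..T} N) + 1 / 2 * integral {0..T} N"
      using cost_expansion[OF costate B(2,1) M state_Lipschitz(1)[OF B(2,1) R]]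
      by (simp only: J_def Q_def d_def)
    also have "\<dots> \<le> M / 2 * (T * d + A * d) + 1 / 2 * (A * d)"
      using M0 N_le \<open>T > 0\<close> by (intro add_mono mult_left_mono) auto
    also have "\<dots> = (C - 1 / 2) * d"
      by (simp add: C_def algebra_simps)
    finally have state_part: "\<bar>J (y \<Theta>') - J (y \<Theta>)
        + ((\<Theta>' - \<Theta>) $ 1 * Q (\<lambda>x. x) + (\<Theta>' - \<Theta>) $ 2 * Q (\<lambda>x. x\<^sup>2))\<bar> \<le> (C - 1 / 2) * d" .
    define e where "e = integral {0..1} (\<lambda>x. (kern (\<Theta>' - \<Theta>) x)\<^sup>2)"
    have e: "0 \<le> e" "e \<le> d"
      unfolding e_def d_def
      by (auto intro!: integral_nonneg integrable_continuous_real continuous_intros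
          continuous_on_kern integral_kern_square_le)
    have "cost T y \<Theta>' - cost T y \<Theta> - (\<Theta>' - \<Theta>) \<bullet> vector [D1, D2]
        = (J (y \<Theta>') - J (y \<Theta>) + ((\<Theta>' - \<Theta>) $ 1 * Q (\<lambda>x. x) + (\<Theta>' - \<Theta>) $ 2 * Q (\<lambda>x. x\<^sup>2)))
          + 1 / 2 * e"
      unfolding cost_def inner_vector2 integral_kern_square e_def J_def Q_def D1_def D2_def
      by (simp add: power2_eq_square field_simps)
    also have "\<bar>\<dots>\<bar> \<le> (C - 1 / 2) * d + 1 / 2 * d"
      using state_part e by linarith
    finally show ?thesis by (simp add: d_def algebra_simps)
  qed
  then have "GDERIV (cost T y) \<Theta> :> vector [D1, D2]"
    by (rule GDERIV_quadratic_remainder)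
  then show ?thesis
    using GDERIV_real2_partials by blast
qed

end
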